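(* Let $M$ be a Riemannian manifold, $\mathcal{F}$ a foliation on $M$, and $p>1$. There exists an extremal function $f_0$ for the $p$-modulus of $\mathcal{F}$ if and only if for every subfamily $\mathcal{L}\subset\mathcal{F}$ (of leaves) such that $\mu_M(\bigcup\mathcal{L})>0$ we have $\mathrm{mod}_p(\mathcal{L})>0$.
   Context: $\mu_M$ and $\mu_L$ denote the Lebesgue (Riemannian volume) measures on $M$ and on a leaf $L\in\mathcal{F}$, respectively, where $\mathcal{F}$ is identified with its set of leaves. $L^p(M)$ is the space of measurable $p$-integrable functions on $M$ with norm $\|\cdot\|_p$. For a subfamily $\mathcal{L}\subset\mathcal{F}$ (possibly $\mathcal{L}=\mathcal{F}$), $\bigcup\mathcal{L}\subset M$ is the union of its leaves; a property holds for almost every $L\in\mathcal{L}$ if the union of those leaves in $\mathcal{L}$ for which it fails has $\mu_M$-measure zero. $\mathrm{adm}_p(\mathcal{L})$ is the family of all nonnegative $f\in L^p(M)$ such that $\int_L f\,d\mu_L\geq 1$ for almost every $L\in\mathcal{L}$. The $p$-modulus of $\mathcal{L}$ is $\mathrm{mod}_p(\mathcal{L})=\inf_{f\in\mathrm{adm}_p(\mathcal{L})}\|f\|_p$ if $\mathrm{adm}_p(\mathcal{L})\neq\emptyset$ and $\mathrm{mod}_p(\mathcal{L})=\infty$ otherwise. A function $f_0\in\mathrm{adm}_p(\mathcal{F})$ is called extremal for the $p$-modulus of $\mathcal{F}$ if $\mathrm{mod}_p(\mathcal{F})=\|f_0\|_p$. The condition $\mu_M(\bigcup\mathcal{L})>0$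 includes measurability of $\bigcup\mathcal{L}$.
   Formalization: The formal theorem additionally assumes mod_p(F) < ∞, i.e. adm_p(F) is nonempty; without it the "if" direction fails, e.g. for vertical segments in {0<x<t<1} with p=2, where no admissible function exists although all subfamilies of positive measure have positive modulus. *)

theory Defs
  imports "HOL-Analysis.Analysis"
begin

section \<open>Smooth manifolds\<close>

text \<open>
  A manifold is the whole of a Hausdorff, second countable type \<open>'a\<close>, modelled on
  \<open>real ^ 'n\<close>; a smooth structure is a maximal smooth atlas. A chart is a pair of its
  domain and its coordinate map (the values of the latter outside the domain are irrelevant).
\<close>

type_synonym ('a, 'n) chart = "'a set \<times> ('a \<Rightarrow> real ^ 'n)"

fun differentiable_upto ::
    "nat \<Rightarrow> 'b::real_normed_vector set \<Rightarrow> ('b \<Rightarrow> 'c::real_normed_vector) \<Rightarrow> bool" where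
  "differentiable_upto 0 S f \<longleftrightarrow> continuous_on S f"
| "differentiable_upto (Suc m) S f \<longleftrightarrow>
     (\<forall>x\<in>S. f differentiable (at x)) \<and>
     (\<forall>v. differentiable_upto m S (\<lambda>x. frechet_derivative f (at x) v))"

text \<open>Only meant for open \<open>S\<close>.\<close>
definition smooth_on :: "'b::real_normed_vector set \<Rightarrow> ('b \<Rightarrow> 'c::real_normed_vector) \<Rightarrow> bool" where
  "smooth_on S f \<longleftrightarrow> (\<forall>m. differentiable_upto m S f)"

definition is_chart :: "('a::topological_space, 'n::finite) chart \<Rightarrow> bool" where
  "is_chart c \<longleftrightarrow> (case c of (U, \<phi>) \<Rightarrow>
     open U \<and> open (\<phi> ` U) \<and> homeomorphism U (\<phi> ` U) \<phi> (inv_into U \<phi>))"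

definition transition :: "('a, 'n) chart \<Rightarrow> ('a, 'n) chart \<Rightarrow> real ^ 'n \<Rightarrow> real ^ 'n" where
  "transition c d = snd d \<circ> inv_into (fst c) (snd c)"

definition smoothly_compatible :: "('a, 'n::finite) chart \<Rightarrow> ('a, 'n) chart \<Rightarrow> bool" where
  "smoothly_compatible c d \<longleftrightarrow>
     smooth_on (snd c ` (fst c \<inter> fst d)) (transition c d) \<and>
     smooth_on (snd d ` (fst c \<inter> fst d)) (transition d c)"

definition smooth_structure :: "('a::{t2_space, second_countable_topology}, 'n::finite) chart set \<Rightarrow> bool" where
  "smooth_structure \<A> \<longleftrightarrow>
     (\<forall>c\<in>\<A>. is_chart c) \<and>
     (\<Union>c\<in>\<A>. fst c) = UNIV \<and>
     (\<forall>c\<in>\<A>. \<forall>d\<in>\<A>. smoothly_compatible c d) \<and>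
     (\<forall>c. is_chart c \<and> (\<forall>d\<in>\<A>. smoothly_compatible c d) \<longrightarrow> c \<in> \<A>)"


section \<open>Riemannian metrics and their volume measures\<close>

text \<open>
  A Riemannian metric is given by its coordinate expressions: \<open>g c y\<close> is the matrix
  \<open>(g\<^sub>i\<^sub>j)\<close> in the chart \<open>c\<close> at the coordinate point \<open>y\<close>.
  The last conjunct is the transformation law of a (0,2)-tensor.
\<close>

definition riemannian_metric ::
    "('a::{t2_space, second_countable_topology}, 'n::finite) chart set \<Rightarrow>
     (('a, 'n) chart \<Rightarrow> real ^ 'n \<Rightarrow> real ^ 'n ^ 'n) \<Rightarrow> bool" where
  "riemannian_metric \<A> g \<longleftrightarrow>
     (\<forall>c\<in>\<A>. \<forall>i j. smooth_on (snd c ` fst c) (\<lambda>y. g c y $ i $ j)) \<and>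
     (\<forall>c\<in>\<A>. \<forall>y\<in>snd c ` fst c.
        transpose (g c y) = g c y \<and> (\<forall>v. v \<noteq> 0 \<longrightarrow> 0 < v \<bullet> (g c y *v v))) \<and>
     (\<forall>c\<in>\<A>. \<forall>d\<in>\<A>. \<forall>x\<in>fst c \<inter> fst d.
        let J = matrix (frechet_derivative (transition c d) (at (snd c x)))
        in g c (snd c x) = transpose J ** g d (snd d x) ** J)"

text \<open>
  The Lebesgue measure of the Riemannian manifold: the completion of the Borel measure which in
  every chart has density \<open>sqrt (det (g\<^sub>i\<^sub>j))\<close>. This determines the measure uniquely.
\<close>

definition riemannian_measure ::
    "('a::{t2_space, second_countable_topology}, 'n::finite) chart set \<Rightarrow>
     (('a, 'n) chart \<Rightarrow> real ^ 'n \<Rightarrow> real ^ 'n ^ 'n) \<Rightarrow> 'a measure \<Rightarrow> bool" where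
  "riemannian_measure \<A> g \<mu> \<longleftrightarrow> (\<exists>\<nu>.
     \<mu> = completion \<nu> \<and> sets \<nu> = sets borel \<and>
     (\<forall>c\<in>\<A>. \<forall>A\<in>sets borel. A \<subseteq> fst c \<longrightarrow>
        emeasure \<nu> A =
          (\<integral>\<^sup>+ y. ennreal (sqrt (det (g c y))) * indicator (snd c ` A) y \<partial>lborel)))"


section \<open>Foliations\<close>

text \<open>
  Throughout, \<open>K :: 'n set\<close> is the set of leaf coordinates, so that leaves have dimension
  \<open>card K\<close> and the codimension is \<open>card (- K)\<close>; both extreme cases are allowed.
\<close>

definition plaque :: "'n set \<Rightarrow> ('a, 'n::finite) chart \<Rightarrow> 'a \<Rightarrow> 'a set" where
  "plaque K c x = {z \<in> fst c. \<forall>i. i \<notin> K \<longrightarrow> snd c z $ i = snd c x $ i}"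

definition plaques :: "'n set \<Rightarrow> ('a, 'n::finite) chart set \<Rightarrow> 'a set set" where
  "plaques K \<Phi> = {plaque K c x | c x. c \<in> \<Phi> \<and> x \<in> fst c}"

text \<open>
  A foliation is given by a foliated atlas: smooth charts whose images are products of open
  (possibly unbounded) intervals, and which are coherently foliated, i.e.\ any two plaques
  intersect in a set open in both of them.
\<close>

definition foliated_atlas ::
    "('a::{t2_space, second_countable_topology}, 'n::finite) chart set \<Rightarrow> 'n set \<Rightarrow>
     ('a, 'n) chart set \<Rightarrow> bool" where
  "foliated_atlas \<A> K \<Phi> \<longleftrightarrow>
     \<Phi> \<subseteq> \<A> \<and>
     (\<Union>c\<in>\<Phi>. fst c) = UNIV \<and>
     (\<forall>c\<in>\<Phi>. \<exists>I. (\<forall>i. open (I i) \<and> is_interval (I i :: real set)) \<and>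
        snd c ` fst c = {y. \<forall>i. y $ i \<in> I i}) \<and>
     (\<forall>P\<in>plaques K \<Phi>. \<forall>Q\<in>plaques K \<Phi>.
        openin (top_of_set P) (P \<inter> Q) \<and> openin (top_of_set Q) (P \<inter> Q))"

text \<open>Two points lie on the same leaf iff they are joined by a chain of plaques.\<close>

definition leaves :: "'n set \<Rightarrow> ('a, 'n::finite) chart set \<Rightarrow> 'a set set" where
  "leaves K \<Phi> = UNIV // {(x, y). \<exists>P\<in>plaques K \<Phi>. x \<in> P \<and> y \<in> P}\<^sup>*"

text \<open>The determinant of the submatrix with rows and columns in \<open>K\<close>: outside the
  \<open>K\<close>-block the matrix is replaced by the identity.\<close>
definition principal_minor :: "'n set \<Rightarrow> real ^ 'n ^ 'n \<Rightarrow> real" where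
  "principal_minor K A =
     det (\<chi> i j. if i \<in> K \<and> j \<in> K then A $ i $ j else if i = j then 1 else 0)"

text \<open>Replaces the leaf coordinates of \<open>y\<close> by \<open>u\<close>.\<close>
definition slice_point :: "'n set \<Rightarrow> real ^ 'n \<Rightarrow> ('n \<Rightarrow> real) \<Rightarrow> real ^ 'n" where
  "slice_point K y u = (\<chi> i. if i \<in> K then u i else y $ i)"

text \<open>
  The Lebesgue measure of a leaf \<open>L\<close> with the induced Riemannian metric. The leaf coordinates
  of the foliated charts are charts of \<open>L\<close> on its plaques, and the induced metric has the
  coordinate matrix \<open>(g\<^sub>i\<^sub>j)\<close> with \<open>i, j \<in> K\<close>. Since \<open>L\<close> is a countable union of plaques and
  plaques are embedded, the Borel sets of the leaf topology are the traces of the Borel sets of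
  the manifold. For \<open>K = {}\<close> this is the counting measure.
\<close>

definition leaf_measure ::
    "(('a::{t2_space, second_countable_topology}, 'n::finite) chart \<Rightarrow>
        real ^ 'n \<Rightarrow> real ^ 'n ^ 'n) \<Rightarrow>
     'n set \<Rightarrow> ('a, 'n) chart set \<Rightarrow> 'a set \<Rightarrow> 'a measure \<Rightarrow> bool" where
  "leaf_measure g K \<Phi> L \<mu> \<longleftrightarrow> (\<exists>\<nu>.
     \<mu> = completion \<nu> \<and> sets \<nu> = sets (restrict_space borel L) \<and>
     (\<forall>c\<in>\<Phi>. \<forall>x\<in>fst c \<inter> L. \<forall>A\<in>sets borel. A \<subseteq> plaque K c x \<longrightarrow>
        emeasure \<nu> A =
          (\<integral>\<^sup>+ u. ennreal (sqrt (principal_minor K (g c (slice_point K (snd c x) u))))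
                  * indicator (snd c ` A) (slice_point K (snd c x) u)
             \<partial>(PiM K (\<lambda>_. lborel)))))"


section \<open>The modulus of a family of leaves\<close>

definition Lp_space :: "real \<Rightarrow> 'a measure \<Rightarrow> ('a \<Rightarrow> real) set" where
  "Lp_space p M = {f \<in> borel_measurable M. integrable M (\<lambda>x. \<bar>f x\<bar> powr p)}"

definition Lp_norm :: "real \<Rightarrow> 'a measure \<Rightarrow> ('a \<Rightarrow> real) \<Rightarrow> real" where
  "Lp_norm p M f = (\<integral>x. \<bar>f x\<bar> powr p \<partial>M) powr (1 / p)"

definition almost_every_leaf :: "'a measure \<Rightarrow> 'a set set \<Rightarrow> ('a set \<Rightarrow> bool) \<Rightarrow> bool" where
  "almost_every_leaf \<mu>M \<L> P \<longleftrightarrow> \<Union>{L \<in> \<L>. \<not> P L} \<in> null_sets \<mu>M"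

text \<open>
  For \<open>f\<close> in \<open>Lp_space p \<mu>M\<close>, the restriction to almost every leaf is measurable with respect to
  the completed leaf measure, so the nonnegative integral below has its usual meaning there.
\<close>

definition adm ::
    "real \<Rightarrow> 'a measure \<Rightarrow> ('a set \<Rightarrow> 'a measure) \<Rightarrow> 'a set set \<Rightarrow> ('a \<Rightarrow> real) set" where
  "adm p \<mu>M \<mu>L \<L> = {f \<in> Lp_space p \<mu>M. (\<forall>x. 0 \<le> f x) \<and>
     almost_every_leaf \<mu>M \<L> (\<lambda>L. 1 \<le> (\<integral>\<^sup>+ x. ennreal (f x) \<partial>\<mu>L L))}"

definition modulus ::
    "real \<Rightarrow> 'a measure \<Rightarrow> ('a set \<Rightarrow> 'a measure) \<Rightarrow> 'a set set \<Rightarrow> ennreal" where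
  "modulus p \<mu>M \<mu>L \<L> =
     (if adm p \<mu>M \<mu>L \<L> = {} then \<infinity> else (INF f\<in>adm p \<mu>M \<mu>L \<L>. ennreal (Lp_norm p \<mu>M f)))"

definition extremal ::
    "real \<Rightarrow> 'a measure \<Rightarrow> ('a set \<Rightarrow> 'a measure) \<Rightarrow> 'a set set \<Rightarrow> ('a \<Rightarrow> real) \<Rightarrow> bool" where
  "extremal p \<mu>M \<mu>L \<F> f\<^sub>0 \<longleftrightarrow>
     f\<^sub>0 \<in> adm p \<mu>M \<mu>L \<F> \<and> modulus p \<mu>M \<mu>L \<F> = ennreal (Lp_norm p \<mu>M f\<^sub>0)"

end

theory Submission
  imports Defs
begin

text \<open>
  If \<open>f\<^sub>0\<close> is extremal but some \<open>\<L>\<close> of positive measure has modulus \<open>0\<close>, replacing \<open>f\<^sub>0\<close> on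
  \<open>\<Union>\<L>\<close> by admissible functions of small norm shows that \<open>f\<^sub>0\<close> vanishes almost everywhere on
  \<open>\<Union>\<L>\<close>; by Fubini in foliated charts its integral over almost every leaf of \<open>\<L>\<close> is then \<open>0\<close>.
  Conversely, a minimizing sequence is Cauchy by strict convexity of \<open>t \<mapsto> t\<^sup>p\<close>. Passing to a
  rapidly convergent subsequence, \<open>f\<^sub>k \<le> f\<^sub>0 + 2 \<cdot> 2\<^sup>-\<^sup>k H\<close> almost everywhere with \<open>H\<close> in \<open>L\<^sup>p\<close>. The leaves
  on which \<open>H\<close> is not integrable form a measurable family of modulus \<open>0\<close>, which is null by
  hypothesis, and on the other leaves the constraint passes to the limit \<open>f\<^sub>0\<close>.

  Measurability of that family and negligibility of the family of leaves that meet a given null set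
  in a set of positive leaf measure both use that a leaf is a countable union of plaques.
\<close>

section \<open>Slices of Euclidean space\<close>

text \<open>Convergence in L^p says nothing about a single leaf, so it is not clear that the limit
  of a minimizing sequence still satisfies the leaf constraint. A pointwise bound by one fixed
  \<open>H\<close> transfers it, but only on leaves where \<open>H\<close> is integrable; on the
  others every multiple \<open>c * H\<close> with \<open>c > 0\<close> is admissible, which is why
  their family has modulus 0. The hypothesis turns modulus 0 into measure 0 only for measurable
  unions, while the leaf measures are given leaf by leaf, with no relation between different leaves.
  The integral over the leaf through \<open>x\<close> therefore has to be rewritten as a Borel
  function of \<open>x\<close>, which requires a countable Borel choice of the plaques of that leaf.
  A second obstacle is that null sets are not stable under saturation by leaves: a transversal may
  be null although the leaves through it fill the manifold. Sets that are open along the leaves are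
  safe, because a plaque that meets such a set meets it in positive measure.\<close>

lemma borel_measurable_vecI:
  fixes f :: "'a \<Rightarrow> real ^ 'n::finite"
  assumes "\<And>i. (\<lambda>x. f x $ i) \<in> borel_measurable M"
  shows "f \<in> borel_measurable M"
proof (subst borel_measurable_euclidean_space, intro ballI)
  fix b :: "real ^ 'n" assume "b \<in> Basis"
  then obtain i where "b = axis i 1" by (auto simp: Basis_vec_def)
  then show "(\<lambda>x. f x \<bullet> b) \<in> borel_measurable M"
    using assms[of i] by (simp add: inner_axis)
qed

lemma prod_Basis_vec: "(\<Prod>b\<in>Basis. (x::real ^ 'n::finite) \<bullet> b) = (\<Prod>i\<in>UNIV. x $ i)"
proof -
  have "(\<Prod>b\<in>Basis. x \<bullet> b) = (\<Prod>b\<in>range (\<lambda>i::'n. axis i (1::real)). x \<bullet> b)"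
    by (intro arg_cong2[where f=prod]) (auto simp: Basis_vec_def)
  also have "\<dots> = (\<Prod>i\<in>UNIV. x $ i)"
    by (subst prod.reindex) (auto simp: inj_on_def axis_eq_axis inner_axis)
  finally show ?thesis .
qed

definition glue :: "'n set \<Rightarrow> ('n \<Rightarrow> real) \<Rightarrow> ('n \<Rightarrow> real) \<Rightarrow> real ^ 'n" where
  "glue K v u = (\<chi> i. if i \<in> K then u i else v i)"

lemma slice_point_nth: "slice_point K y u $ i = (if i \<in> K then u i else y $ i)"
  by (simp add: slice_point_def)

lemma slice_point_glue: "slice_point K (glue K v u) w = glue K v w"
  by (simp add: vec_eq_iff slice_point_nth glue_def)

lemma measurable_glue [measurable]:
  "(\<lambda>(v, u). glue K v u) \<in> borel_measurable (PiM (- K) (\<lambda>_. lborel) \<Otimes>\<^sub>M PiM K (\<lambda>_. lborel))"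
proof (rule borel_measurable_vecI)
  fix i
  show "(\<lambda>x. (case x of (v, u) \<Rightarrow> glue K v u) $ i)
    \<in> borel_measurable (PiM (- K) (\<lambda>_. lborel) \<Otimes>\<^sub>M PiM K (\<lambda>_. lborel))"
  proof (cases "i \<in> K")
    case True
    then have "(\<lambda>x. (case x of (v, u) \<Rightarrow> glue K v u) $ i) = (\<lambda>x. snd x i)"
      by (auto simp: glue_def)
    then show ?thesis using True by simp
  next
    case False
    then have "(\<lambda>x. (case x of (v, u) \<Rightarrow> glue K v u) $ i) = (\<lambda>x. fst x i)"
      by (auto simp: glue_def)
    then show ?thesis using False by simp
  qed
qed

lemma measurable_slice_point_pair [measurable]:
  "(\<lambda>(y, u). slice_point K y u) \<in> borel_measurable (borel \<Otimes>\<^sub>M PiM K (\<lambda>_. lborel))"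
proof (rule borel_measurable_vecI)
  fix i
  show "(\<lambda>x. (case x of (v, u) \<Rightarrow> slice_point K v u) $ i) \<in> borel_measurable (borel \<Otimes>\<^sub>M PiM K (\<lambda>_. lborel))"
  proof (cases "i \<in> K")
    case True
    then have "(\<lambda>x. (case x of (v, u) \<Rightarrow> slice_point K v u) $ i) = (\<lambda>x. snd x i)"
      by (auto simp: slice_point_nth)
    then show ?thesis using True by simp
  next
    case False
    then have "(\<lambda>x. (case x of (v, u) \<Rightarrow> slice_point K v u) $ i) = (\<lambda>y. y $ i) \<circ> fst"
      by (auto simp: slice_point_nth)
    then show ?thesis
      using measurable_comp[OF measurable_fst borel_measurable_nth] by (metis (no_types))
  qed
qed

lemma measurable_slice_point [measurable]:
  "slice_point K y \<in> borel_measurable (PiM K (\<lambda>_. lborel))"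
  using measurable_Pair2[OF measurable_slice_point_pair, of y K] by simp

text \<open>Leaf measures are given on \<open>PiM K\<close> and the volume on
  \<open>real ^ 'n\<close>; this puts both into one product, so that Tonelli applies. Open boxes
  determine Lebesgue measure, and on a box both sides are the product of the side lengths, split
  over \<open>- K\<close> and \<open>K\<close>. For \<open>K = {}\<close> or \<open>K = UNIV\<close>
  one factor is a single point of mass 1.\<close>

lemma lborel_eq_distr_glue:
  "(lborel :: (real ^ 'n::finite) measure) =
     distr (PiM (- K) (\<lambda>_. lborel) \<Otimes>\<^sub>M PiM K (\<lambda>_. lborel)) borel (\<lambda>(v, u). glue K v u)"
proof (rule lborel_eqI)
  interpret product_sigma_finite "\<lambda>_::'n. lborel :: real measure" ..
  interpret sigma_finite_measure "PiM K (\<lambda>_::'n. lborel :: real measure)"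
    by (rule sigma_finite) simp
  fix l u :: "real ^ 'n" assume le: "\<And>b. b \<in> Basis \<Longrightarrow> l \<bullet> b \<le> u \<bullet> b"
  have le': "l $ i \<le> u $ i" for i
    using le[of "axis i 1"] by (simp add: inner_axis)
  let ?A = "\<lambda>J. PiE J (\<lambda>i. {l $ i <..< u $ i})"
  have eq: "(\<lambda>(v, w). glue K v w) -` box l u \<inter> space (PiM (- K) (\<lambda>_. lborel) \<Otimes>\<^sub>M PiM K (\<lambda>_. lborel))
      = ?A (- K) \<times> ?A K" (is "?lhs = ?rhs")
  proof (intro set_eqI iffI)
    fix x assume x: "x \<in> ?lhs"
    obtain x1 x2 where xx: "x = (x1, x2)" by (cases x)
    have "\<forall>i. l $ i < (if i \<in> K then x2 i else x1 i) \<and> (if i \<in> K then x2 i else x1 i) < u $ i"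
      and s: "x1 \<in> PiE (- K) (\<lambda>_. UNIV)" "x2 \<in> PiE K (\<lambda>_. UNIV)"
      using x unfolding xx
      by (simp_all add: mem_box_cart glue_def space_pair_measure space_PiM split del: if_split)
    then have b: "l $ i < (if i \<in> K then x2 i else x1 i)" "(if i \<in> K then x2 i else x1 i) < u $ i" for i
      by blast+
    show "x \<in> ?rhs"
    unfolding xx
    proof (rule SigmaI)
      show "x1 \<in> ?A (- K)"
      proof (rule PiE_I)
        fix i assume "i \<in> - K" then show "x1 i \<in> {l $ i<..<u $ i}" using b(1)[of i] b(2)[of i] by auto
      qed (use s in auto)
      show "x2 \<in> ?A K"
      proof (rule PiE_I)
        fix i assume "i \<in> K" then show "x2 i \<in> {l $ i<..<u $ i}" using b(1)[of i] b(2)[of i] by auto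
      qed (use s in auto)
    qed
  next
    fix x assume "x \<in> ?rhs"
    then show "x \<in> ?lhs"
      by (auto simp: mem_box_cart glue_def space_pair_measure space_PiM PiE_iff)
  qed
  have "emeasure (distr (PiM (- K) (\<lambda>_. lborel) \<Otimes>\<^sub>M PiM K (\<lambda>_. lborel)) borel (\<lambda>(v, u). glue K v u)) (box l u)
     = emeasure (PiM (- K) (\<lambda>_. lborel) \<Otimes>\<^sub>M PiM K (\<lambda>_. lborel)) (?A (- K) \<times> ?A K)"
    by (subst emeasure_distr) (simp_all add: eq)
  also have "\<dots> = emeasure (PiM (- K) (\<lambda>_. lborel)) (?A (- K)) * emeasure (PiM K (\<lambda>_. lborel)) (?A K)"
    by (rule emeasure_pair_measure_Times) (auto intro!: sets_PiM_I_finite)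
  also have "\<dots> = (\<Prod>i\<in>-K. ennreal (u $ i - l $ i)) * (\<Prod>i\<in>K. ennreal (u $ i - l $ i))"
    using le' by (simp add: emeasure_PiM)
  also have "\<dots> = (\<Prod>i\<in>UNIV. ennreal (u $ i - l $ i))"
    by (subst prod.union_disjoint[symmetric]) (auto intro: prod.cong)
  also have "\<dots> = ennreal (\<Prod>b\<in>Basis. (u - l) \<bullet> b)"
    using le' by (simp add: prod_Basis_vec prod_ennreal)
  finally show "emeasure (distr (PiM (- K) (\<lambda>_. lborel) \<Otimes>\<^sub>M PiM K (\<lambda>_. lborel)) borel (\<lambda>(v, u). glue K v u)) (box l u)
    = ennreal (\<Prod>b\<in>Basis. (u - l) \<bullet> b)" .
qed simp

text \<open>The value depends only on the coordinates of \<open>y\<close> outside \<open>K\<close>,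
  so it is constant on each plaque of a chart.\<close>

definition null_slice :: "'n set \<Rightarrow> (real ^ 'n) set \<Rightarrow> real ^ 'n \<Rightarrow> bool" where
  "null_slice K S y \<longleftrightarrow> (\<integral>\<^sup>+ u. indicator S (slice_point K y u) \<partial>PiM K (\<lambda>_. lborel)) = 0"

lemma measurable_slice_integral [measurable]:
  fixes h :: "real ^ 'n::finite \<Rightarrow> ennreal"
  assumes [measurable]: "h \<in> borel_measurable borel"
  shows "(\<lambda>y. \<integral>\<^sup>+ u. h (slice_point K y u) \<partial>PiM K (\<lambda>_. lborel)) \<in> borel_measurable borel"
proof -
  interpret product_sigma_finite "\<lambda>_::'n. lborel :: real measure" ..
  interpret sigma_finite_measure "PiM K (\<lambda>_::'n. lborel :: real measure)"
    by (rule sigma_finite) simp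
  have "case_prod (\<lambda>y u. h (slice_point K y u)) = h \<circ> (\<lambda>(y, u). slice_point K y u)" by auto
  moreover have "\<dots> \<in> borel_measurable (borel \<Otimes>\<^sub>M PiM K (\<lambda>_. lborel))"
    by (rule measurable_comp[OF measurable_slice_point_pair]) fact
  ultimately show ?thesis by (intro borel_measurable_nn_integral) simp
qed

lemma nn_integral_lborel_glue:
  fixes h :: "real ^ 'n::finite \<Rightarrow> ennreal"
  assumes [measurable]: "h \<in> borel_measurable borel"
  shows "(\<integral>\<^sup>+ y. h y \<partial>lborel) =
    (\<integral>\<^sup>+ v. \<integral>\<^sup>+ u. h (glue K v u) \<partial>PiM K (\<lambda>_. lborel) \<partial>PiM (- K) (\<lambda>_. lborel))"
proof -
  interpret product_sigma_finite "\<lambda>_::'n. lborel :: real measure" ..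
  interpret sigma_finite_measure "PiM K (\<lambda>_::'n. lborel :: real measure)"
    by (rule sigma_finite) simp
  have m: "(\<lambda>x. h ((\<lambda>(v, u). glue K v u) x)) \<in> borel_measurable (PiM (- K) (\<lambda>_. lborel) \<Otimes>\<^sub>M PiM K (\<lambda>_. lborel))"
    by measurable
  have "(\<integral>\<^sup>+ y. h y \<partial>lborel) = (\<integral>\<^sup>+ x. h ((\<lambda>(v, u). glue K v u) x) \<partial>(PiM (- K) (\<lambda>_. lborel) \<Otimes>\<^sub>M PiM K (\<lambda>_. lborel)))"
    by (subst lborel_eq_distr_glue[of K], subst nn_integral_distr) auto
  also have "\<dots> = (\<integral>\<^sup>+ v. \<integral>\<^sup>+ u. h (glue K v u) \<partial>PiM K (\<lambda>_. lborel) \<partial>PiM (- K) (\<lambda>_. lborel))"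
    using nn_integral_fst[OF m] by simp
  finally show ?thesis .
qed

text \<open>Tonelli makes almost every transversal parameter \<open>v\<close> good. Since badness of
  \<open>glue K v u\<close> depends on \<open>v\<close> alone, the bad points form a cylinder over a
  null set, and a second use of Tonelli shows that it is null.\<close>

lemma null_sets_non_null_slices:
  fixes S :: "(real ^ 'n::finite) set"
  assumes S: "S \<in> null_sets lborel"
  shows "{y. \<not> null_slice K S y} \<in> null_sets lborel"
proof -
  have [measurable]: "S \<in> sets borel" using S by auto
  let ?I = "\<lambda>y. \<integral>\<^sup>+ u. indicator S (slice_point K y u) \<partial>PiM K (\<lambda>_. lborel)"
  have mI [measurable]: "?I \<in> borel_measurable borel"
    by (rule measurable_slice_integral) measurable
  have T: "{y. \<not> null_slice K S y} = {y\<in>space borel. ?I y \<noteq> 0}" by (simp add: null_slice_def)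
  have sT [measurable]: "{y. \<not> null_slice K S y} \<in> sets borel" unfolding T by measurable
  let ?J = "\<lambda>v. \<integral>\<^sup>+ u. indicator S (glue K v u) \<partial>PiM K (\<lambda>_. lborel)"
  interpret product_sigma_finite "\<lambda>_::'n. lborel :: real measure" ..
  interpret sigma_finite_measure "PiM K (\<lambda>_::'n. lborel :: real measure)"
    by (rule sigma_finite) simp
  have mJ: "?J \<in> borel_measurable (PiM (- K) (\<lambda>_. lborel))"
  proof (rule borel_measurable_nn_integral)
    have "case_prod (\<lambda>v u. indicator S (glue K v u) :: ennreal) = indicator S \<circ> (\<lambda>(y, u). glue K y u)" by auto
    moreover have "\<dots> \<in> borel_measurable (PiM (- K) (\<lambda>_. lborel) \<Otimes>\<^sub>M PiM K (\<lambda>_. lborel))"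
      by (rule measurable_comp[OF measurable_glue]) measurable
    ultimately show "case_prod (\<lambda>v u. indicator S (glue K v u) :: ennreal)
       \<in> borel_measurable (PiM (- K) (\<lambda>_. lborel) \<Otimes>\<^sub>M PiM K (\<lambda>_. lborel))" by simp
  qed
  have "(\<integral>\<^sup>+ v. ?J v \<partial>PiM (- K) (\<lambda>_. lborel)) = (\<integral>\<^sup>+ y. indicator S y \<partial>lborel)"
    by (rule nn_integral_lborel_glue[symmetric]) measurable
  also have "\<dots> = 0" using S by auto
  finally have "AE v in PiM (- K) (\<lambda>_. lborel). ?J v = 0"
    using mJ by (simp add: nn_integral_0_iff_AE)
  moreover have "glue K v u \<in> {y. \<not> null_slice K S y} \<longleftrightarrow> ?J v \<noteq> 0" for v u
    by (simp add: null_slice_def slice_point_glue)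
  ultimately have ae: "AE v in PiM (- K) (\<lambda>_. lborel). (\<integral>\<^sup>+ u. indicator {y. \<not> null_slice K S y} (glue K v u) \<partial>PiM K (\<lambda>_. lborel)) = 0"
    by (auto simp: indicator_def)
  have "emeasure lborel {y. \<not> null_slice K S y} = (\<integral>\<^sup>+ y. indicator {y. \<not> null_slice K S y} y \<partial>lborel)"
    by simp
  also have "\<dots> = (\<integral>\<^sup>+ v. \<integral>\<^sup>+ u. indicator {y. \<not> null_slice K S y} (glue K v u) \<partial>PiM K (\<lambda>_. lborel) \<partial>PiM (- K) (\<lambda>_. lborel))"
    by (rule nn_integral_lborel_glue) measurable
  also have "\<dots> = (\<integral>\<^sup>+ v. 0 \<partial>PiM (- K) (\<lambda>_. lborel :: real measure))"
    using ae by (intro nn_integral_cong_AE) simp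
  finally show ?thesis by (simp add: null_sets_def)
qed

text \<open>Around \<open>z\<close> the set \<open>W\<close> contains a box; the slice through
  \<open>y\<close> cuts it in a product of nonempty open intervals over \<open>K\<close>, which has
  positive measure (1 for \<open>K = {}\<close>). This is what gives leafwise open sets positive
  measure along plaques.\<close>

lemma not_null_slice_open:
  fixes W :: "(real ^ 'n::finite) set"
  assumes W: "open W" "z \<in> W" and agree: "\<And>i. i \<notin> K \<Longrightarrow> z $ i = y $ i"
    and S: "S \<in> sets borel" and sub: "\<And>x. x \<in> W \<Longrightarrow> (\<And>i. i \<notin> K \<Longrightarrow> x $ i = y $ i) \<Longrightarrow> x \<in> S"
  shows "\<not> null_slice K S y"
proof
  assume null: "null_slice K S y"
  note [measurable] = S
  obtain a b where ab: "z \<in> box a b" "box a b \<subseteq> W"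
    using open_contains_box[of W] W by metis
  let ?A = "PiE K (\<lambda>i. {a $ i <..< b $ i})"
  have lt: "a $ i < b $ i" for i using ab(1) by (auto simp: mem_box_cart intro: less_trans)
  interpret product_sigma_finite "\<lambda>_::'n. lborel :: real measure" ..
  have "emeasure (PiM K (\<lambda>_. lborel)) ?A = (\<Prod>i\<in>K. ennreal (b $ i - a $ i))"
    using lt by (simp add: emeasure_PiM less_imp_le)
  also have "\<dots> = ennreal (\<Prod>i\<in>K. b $ i - a $ i)"
    using lt by (simp add: prod_ennreal less_imp_le)
  also have "\<dots> \<noteq> 0" using prod_pos[of K "\<lambda>i. b $ i - a $ i"] lt by (simp only: diff_gt_0_iff_gt ennreal_eq_0_iff not_le simp_thms)
  finally have pos: "emeasure (PiM K (\<lambda>_. lborel)) ?A \<noteq> 0" .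
  have "emeasure (PiM K (\<lambda>_. lborel)) ?A = (\<integral>\<^sup>+ u. indicator ?A u \<partial>PiM K (\<lambda>_. lborel))"
    by (rule nn_integral_indicator[symmetric]) (auto intro!: sets_PiM_I_finite)
  also have "\<dots> \<le> (\<integral>\<^sup>+ u. indicator S (slice_point K y u) \<partial>PiM K (\<lambda>_. lborel))"
  proof (rule nn_integral_mono)
    fix u :: "'n \<Rightarrow> real"
    have "slice_point K y u \<in> S" if "u \<in> ?A"
    proof (rule sub)
      have "slice_point K y u \<in> box a b"
        using that ab(1) by (auto simp: mem_box_cart slice_point_nth PiE_iff agree[symmetric])
      then show "slice_point K y u \<in> W" using ab(2) by auto
    qed (simp add: slice_point_nth)
    then show "(indicator ?A u :: ennreal) \<le> indicator S (slice_point K y u)"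
      by (auto simp: indicator_def)
  qed
  also have "\<dots> = 0" using null by (simp add: null_slice_def)
  finally show False using pos by simp
qed

text \<open>Along the segment from the identity to \<open>A\<close> every matrix is positive
  definite, hence invertible, so \<open>det\<close> keeps the sign that it has at the identity.
  Volume densities in charts are positive for this reason.\<close>

lemma det_posdef_pos:
  fixes A :: "real ^ 'n::finite ^ 'n"
  assumes pos: "\<And>v. v \<noteq> 0 \<Longrightarrow> 0 < v \<bullet> (A *v v)"
  shows "0 < det A"
proof -
  define B where "B t = t *\<^sub>R A + (1 - t) *\<^sub>R mat 1" for t :: real
  have nz: "det (B t) \<noteq> 0" if "t \<in> {0..1}" for t
  proof -
    have "v = 0" if "B t *v v = 0" for v
    proof (rule ccontr)
      assume v: "v \<noteq> 0"
      have "v \<bullet> (B t *v v) = t * (v \<bullet> (A *v v)) + (1 - t) * (v \<bullet> v)"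
        by (simp add: B_def matrix_vector_mult_add_rdistrib inner_add_right scaleR_matrix_vector_assoc[symmetric])
      moreover have "\<dots> > 0"
      proof (cases "t = 0")
        case False
        then have "0 < t * (v \<bullet> (A *v v))" using pos[OF v] \<open>t \<in> _\<close> by simp
        moreover have "0 \<le> (1 - t) * (v \<bullet> v)" using \<open>t \<in> _\<close> by simp
        ultimately show ?thesis by linarith
      qed (use v in simp)
      ultimately show False using that by simp
    qed
    then have "invertible (B t)"
      by (simp add: invertible_left_inverse matrix_left_invertible_ker)
    then show ?thesis using invertible_det_nz by blast
  qed
  have cont: "continuous_on {0..1} (\<lambda>t. det (B t))"
    unfolding B_def det_def by (auto intro!: continuous_intros)
  show ?thesis
  proof (rule ccontr)
    assume "\<not> 0 < det A"
    then have "det (B 1) \<le> 0" by (simp add: B_def)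
    moreover have "0 \<le> det (B 0)" by (simp add: B_def)
    ultimately obtain t where "0 \<le> t" "t \<le> 1" "det (B t) = 0"
      using IVT2'[of "\<lambda>t. det (B t)" 1 0 0] cont by auto
    then show False using nz[of t] by auto
  qed
qed

section \<open>Strict convexity\<close>

text \<open>The tangent of \<open>u powr p\<close> at 1, by the mean value theorem. The strict form
  concerns \<open>u > 1\<close> because the larger of two distinct positive numbers, divided by
  their mean, exceeds 1.\<close>

lemma Bernoulli_powr_strict:
  fixes u p :: real
  assumes "1 < p" "1 < u"
  shows "1 + p * (u - 1) < u powr p"
proof -
  have "\<exists>z>1. z < u \<and> u powr p - 1 powr p = (u - 1) * (p * z powr (p - 1))"
    using assms by (intro MVT2) (auto intro!: derivative_eq_intros)
  then obtain z where z: "1 < z" "z < u" "u powr p - 1 = (u - 1) * (p * z powr (p - 1))"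
    by auto
  have "1 < z powr (p - 1)" using z assms by (intro gr_one_powr) auto
  then have "(u - 1) * (p * 1) < (u - 1) * (p * z powr (p - 1))"
    using assms by (intro mult_strict_left_mono) auto
  then show ?thesis using z(3) by (simp add: algebra_simps)
qed

lemma Bernoulli_powr:
  fixes u p :: real
  assumes "1 < p" "0 \<le> u"
  shows "1 + p * (u - 1) \<le> u powr p"
proof -
  consider "u = 0" | "u = 1" | "1 < u" | "0 < u" "u < 1" using assms by linarith
  then show ?thesis
  proof cases
    case 4
    then have "\<exists>z>u. z < 1 \<and> 1 powr p - u powr p = (1 - u) * (p * z powr (p - 1))"
      by (intro MVT2) (auto intro!: derivative_eq_intros)
    then obtain z where z: "u < z" "z < 1" "1 - u powr p = (1 - u) * (p * z powr (p - 1))"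
      by auto
    have "z powr (p - 1) \<le> 1" using z 4 assms by (intro powr_le1) auto
    then have "(1 - u) * (p * z powr (p - 1)) \<le> (1 - u) * (p * 1)"
      using assms 4 by (intro mult_left_mono) auto
    then show ?thesis using z(3) by (simp add: algebra_simps)
  qed (use assms Bernoulli_powr_strict[of p u] in auto)
qed

text \<open>Dividing 1 and \<open>t\<close> by their mean \<open>s\<close> gives numbers with mean
  1, for which the tangent terms add up to exactly 2; the tangent bound is strict at
  \<open>1 / s > 1\<close>.\<close>

lemma powr_midpoint_less:
  fixes t p :: real
  assumes p: "1 < p" and t: "0 \<le> t" "t < 1"
  shows "((1 + t) / 2) powr p < (1 + t powr p) / 2"
proof -
  have tangent_sum: "(1 + p * (x - 1)) + (1 + p * (y - 1)) = 2" if "x + y = 2" for x y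
  proof -
    have "y = 2 - x" using that by simp
    show ?thesis unfolding \<open>y = 2 - x\<close> by (simp add: algebra_simps)
  qed
  define s where "s = (1 + t) / 2"
  have s: "0 < s" "s < 1" using t by (auto simp: s_def)
  have "1 + p * (1 / s - 1) < (1 / s) powr p"
    using s p by (intro Bernoulli_powr_strict) auto
  moreover have "1 + p * (t / s - 1) \<le> (t / s) powr p"
    using s p t by (intro Bernoulli_powr) auto
  moreover have "1 + t = 2 * s" by (simp add: s_def)
  then have "1 / s + t / s = 2" using s by (simp add: add_divide_distrib[symmetric])
  then have "(1 + p * (1 / s - 1)) + (1 + p * (t / s - 1)) = 2" by (rule tangent_sum)
  ultimately have "2 < (1 / s) powr p + (t / s) powr p" by linarith
  also have "\<dots> = (1 + t powr p) / s powr p"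
    using s t by (simp add: powr_divide add_divide_distrib)
  finally have "2 * s powr p < 1 + t powr p" using s by (simp add: pos_less_divide_eq)
  then show ?thesis by (simp add: s_def)
qed

lemma powr_midpoint_le:
  fixes a b p :: real
  assumes p: "1 < p" and ab: "0 \<le> a" "0 \<le> b"
  shows "((a + b) / 2) powr p \<le> (a powr p + b powr p) / 2"
proof (cases "a + b = 0")
  case False
  have tangent_sum: "(1 + p * (x - 1)) + (1 + p * (y - 1)) = 2" if "x + y = 2" for x y
  proof -
    have "y = 2 - x" using that by simp
    show ?thesis unfolding \<open>y = 2 - x\<close> by (simp add: algebra_simps)
  qed
  define s where "s = (a + b) / 2"
  have s: "0 < s" using False ab by (simp add: s_def)
  have "1 + p * (a / s - 1) \<le> (a / s) powr p" "1 + p * (b / s - 1) \<le> (b / s) powr p"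
    using s p ab by (auto intro!: Bernoulli_powr)
  moreover have "a + b = 2 * s" by (simp add: s_def)
  then have "a / s + b / s = 2" using s by (simp add: add_divide_distrib[symmetric])
  then have "(1 + p * (a / s - 1)) + (1 + p * (b / s - 1)) = 2" by (rule tangent_sum)
  ultimately have "2 \<le> (a / s) powr p + (b / s) powr p" by linarith
  also have "\<dots> = (a powr p + b powr p) / s powr p"
    using s ab by (simp add: powr_divide add_divide_distrib)
  finally have "2 * s powr p \<le> a powr p + b powr p" using s by (simp add: pos_le_divide_eq)
  then show ?thesis by (simp add: s_def)
qed (use p ab in \<open>simp add: add_nonneg_eq_0_iff\<close>)

text \<open>
  A quantitative form of strict convexity: by homogeneity the right-hand side may be compared with
  the left-hand side on a compact set, where the midpoint deficit is bounded away from zero.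
  It replaces Clarkson's inequalities uniformly in the exponent.
\<close>

lemma powr_diff_le_midpoint_deficit:
  fixes p e :: real
  assumes p: "1 < p" and e: "0 < e"
  obtains C where "0 \<le> C"
    "\<And>a b. 0 \<le> a \<Longrightarrow> 0 \<le> b \<Longrightarrow> \<bar>a - b\<bar> powr p \<le>
       e * (a powr p + b powr p) + C * ((a powr p + b powr p) / 2 - ((a + b) / 2) powr p)"
proof -
  define F where "F t = (1 + t powr p) / 2 - ((1 + t) / 2) powr p" for t
  \<comment> \<open>Off \<open>T\<close> the term with \<open>e\<close> alone suffices;
    \<open>T\<close> is compact and omits 1, the only zero of \<open>F\<close> in the unit
    interval.\<close>
  define T where "T = {t\<in>{0..1}. e \<le> (1 - t) powr p}"
  have T1: "t < 1" if "t \<in> T" for t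
    using that e by (cases "t = 1") (auto simp: T_def)
  have contF: "continuous_on {0..1} F"
    unfolding F_def using p by (auto intro!: continuous_intros continuous_on_powr')
  have "continuous_on {0..1} (\<lambda>t. (1 - t) powr p)"
    using p by (auto intro!: continuous_intros continuous_on_powr')
  then have "closed ({0..1} \<inter> (\<lambda>t. (1 - t) powr p) -` {e..})"
    by (intro continuous_closed_preimage) auto
  also have "{0..1} \<inter> (\<lambda>t. (1 - t) powr p) -` {e..} = T" by (auto simp: T_def)
  finally have "compact T"
    using bounded_subset[of "{0..1::real}" T]
    by (simp add: compact_eq_bounded_closed T_def subset_eq)
  have F0: "0 \<le> F t" if "0 \<le> t" "t \<le> 1" for t
    using powr_midpoint_less[OF p, of t] that by (cases "t = 1") (auto simp: F_def)
  \<comment> \<open>On a nonempty \<open>T\<close> the deficit has a positive minimum, whose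
    reciprocal serves as \<open>C\<close> because \<open>(1 - t) powr p\<close> never exceeds
    1.\<close>
  obtain C where C: "0 \<le> C" "\<And>t. t \<in> T \<Longrightarrow> 1 \<le> C * F t"
  proof (cases "T = {}")
    case True
    then show ?thesis using that[of 0] by simp
  next
    case False
    have "T \<subseteq> {0..1}" by (auto simp: T_def)
    then obtain t0 where t0: "t0 \<in> T" "\<And>t. t \<in> T \<Longrightarrow> F t0 \<le> F t"
      using continuous_attains_inf[OF \<open>compact T\<close> False continuous_on_subset[OF contF]] by blast
    have pos: "0 < F t0"
      using powr_midpoint_less[OF p, of t0] t0(1) T1[of t0] by (auto simp: F_def T_def)
    show ?thesis
      by (rule that[of "1 / F t0"]) (use pos t0 in \<open>auto simp: field_simps\<close>)
  qed
  have unit: "(1 - t) powr p \<le> e * (1 + t powr p) + C * F t" if t: "0 \<le> t" "t \<le> 1" for t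
  proof (cases "t \<in> T")
    case True
    have "(1 - t) powr p \<le> 1" using t p by (intro powr_le1) auto
    then show ?thesis using C(2)[OF True] e powr_ge_zero[of t p]
      by (smt (verit) mult_nonneg_nonneg)
  next
    case False
    then have "(1 - t) powr p \<le> e" using t by (auto simp: T_def)
    also have "\<dots> \<le> e * (1 + t powr p)" using e by simp
    finally show ?thesis using C(1) F0[OF t] by (smt (verit) mult_nonneg_nonneg)
  qed
  \<comment> \<open>Both sides are homogeneous of degree \<open>p\<close>, which reduces the pair to
    1 and \<open>t = b / a\<close>.\<close>
  have ordered: "\<bar>a - b\<bar> powr p \<le>
       e * (a powr p + b powr p) + C * ((a powr p + b powr p) / 2 - ((a + b) / 2) powr p)"
    if ab: "0 \<le> b" "b \<le> a" for a b
  proof (cases "a = 0")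
    case False
    then have a: "0 < a" using ab by simp
    define t where "t = b / a"
    have t: "0 \<le> t" "t \<le> 1" "b = a * t" using ab a by (auto simp: t_def)
    have q: "\<bar>a - b\<bar> = a * (1 - t)" "(a + b) / 2 = a * ((1 + t) / 2)"
      using t(3) ab by (auto simp: algebra_simps add_divide_distrib)
    have "\<bar>a - b\<bar> powr p = a powr p * (1 - t) powr p"
      unfolding q by (rule powr_mult)
    moreover have "((a + b) / 2) powr p = a powr p * ((1 + t) / 2) powr p"
      unfolding q by (rule powr_mult)
    moreover have "b powr p = a powr p * t powr p"
      unfolding t(3) by (rule powr_mult)
    moreover have "a powr p * (1 - t) powr p \<le> a powr p * (e * (1 + t powr p) + C * F t)"
      using unit[OF t(1,2)] by (intro mult_left_mono) auto
    ultimately show ?thesis by (simp add: F_def algebra_simps add_divide_distrib)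
  qed (use ab p in simp)
  show ?thesis
  proof (rule that[OF C(1)])
    fix a b :: real assume "0 \<le> a" "0 \<le> b"
    then show "\<bar>a - b\<bar> powr p \<le>
       e * (a powr p + b powr p) + C * ((a powr p + b powr p) / 2 - ((a + b) / 2) powr p)"
      using ordered[of b a] ordered[of a b]
      by (cases "b \<le> a") (auto simp: abs_minus_commute add.commute)
  qed
qed

section \<open>Extremal functions of a family of leaves\<close>

text \<open>Completeness enters here: the union of the leaves that violate \<open>Q\<close> is not
  known to be measurable, but it lies in a null set.\<close>

lemma almost_every_leaf_mono:
  assumes "almost_every_leaf (completion N) F P" "\<And>L. L \<in> F \<Longrightarrow> P L \<Longrightarrow> Q L"
  shows "almost_every_leaf (completion N) F Q"
  using assms unfolding almost_every_leaf_def
  by (intro null_sets_completion_subset[OF _ assms(1)[unfolded almost_every_leaf_def]]) auto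

lemma almost_every_leaf_conj:
  assumes "almost_every_leaf (completion N) F P" "almost_every_leaf (completion N) F Q"
  shows "almost_every_leaf (completion N) F (\<lambda>L. P L \<and> Q L)"
proof -
  have "\<Union>{L \<in> F. \<not> (P L \<and> Q L)} = \<Union>{L \<in> F. \<not> P L} \<union> \<Union>{L \<in> F. \<not> Q L}" by auto
  then show ?thesis using assms unfolding almost_every_leaf_def by (simp only: null_sets.Un)
qed

lemma almost_every_leaf_all_nat:
  fixes P :: "nat \<Rightarrow> 'a set \<Rightarrow> bool"
  assumes "\<And>k. almost_every_leaf (completion N) F (P k)"
  shows "almost_every_leaf (completion N) F (\<lambda>L. \<forall>k. P k L)"
proof -
  have "\<Union>{L \<in> F. \<not> (\<forall>k. P k L)} = (\<Union>k. \<Union>{L \<in> F. \<not> P k L})" by auto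
  then show ?thesis using assms unfolding almost_every_leaf_def by (simp only: null_sets_UN)
qed

text \<open>The \<open>p\<close>-th power of the norm: unlike the norm it is additive over disjoint
  regions, and taking roots is monotone, so both have the same minimizers.\<close>

definition energy :: "real \<Rightarrow> 'a measure \<Rightarrow> ('a \<Rightarrow> real) \<Rightarrow> real" where
  "energy p M f = (\<integral>x. \<bar>f x\<bar> powr p \<partial>M)"

lemma energy_nonneg: "0 \<le> energy p M f"
  by (simp add: energy_def)

lemma energy_cong_AE:
  assumes "f \<in> borel_measurable M" "g \<in> borel_measurable M" "AE x in M. f x = g x"
  shows "energy p M f = energy p M g"
  unfolding energy_def using assms by (intro integral_cong_AE) auto

lemma Lp_norm_energy: "Lp_norm p M f = energy p M f powr (1 / p)"
  by (simp add: Lp_norm_def energy_def)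

lemma Lp_space_cong_AE:
  assumes "f \<in> Lp_space p M" "g \<in> borel_measurable M" "AE x in M. f x = g x"
  shows "g \<in> Lp_space p M"
proof -
  have "integrable M (\<lambda>x. \<bar>f x\<bar> powr p) \<longleftrightarrow> integrable M (\<lambda>x. \<bar>g x\<bar> powr p)"
    using assms by (intro integrable_cong_AE) (auto simp: Lp_space_def)
  then show ?thesis using assms by (simp add: Lp_space_def)
qed

lemma Lp_space_scale: "0 \<le> c \<Longrightarrow> f \<in> Lp_space p M \<Longrightarrow> (\<lambda>x. c * f x) \<in> Lp_space p M"
  by (auto simp: Lp_space_def abs_mult powr_mult)

lemma Lp_norm_scale:
  assumes "0 \<le> c" "0 < p"
  shows "Lp_norm p M (\<lambda>x. c * f x) = c * Lp_norm p M f"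
  using assms by (simp add: Lp_norm_def abs_mult powr_mult powr_powr)

text \<open>What the analysis takes from the foliation. \<open>null_leaf\<close> is the Fubini
  property. \<open>measurable_leaf\<close> speaks of \<open>N\<close>, since a function that is
  measurable only for the completion may fail to be measurable on exceptional leaves.
  \<open>infinite_leaf\<close> supplies the measurability without which the hypothesis on
  subfamilies could not be applied.\<close>

locale leaf_family =
  fixes N :: "'a measure" and \<mu> :: "'a set \<Rightarrow> 'a measure" and F :: "'a set set"
    and M :: "'a measure"
  assumes M_completion: "M = completion N"
    and space_N: "space N = UNIV"
    and leaves_disjoint: "L \<in> F \<Longrightarrow> L' \<in> F \<Longrightarrow> x \<in> L \<Longrightarrow> x \<in> L' \<Longrightarrow> L = L'"
    and space_leaf: "L \<in> F \<Longrightarrow> space (\<mu> L) = L"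
    and measurable_leaf: "L \<in> F \<Longrightarrow> h \<in> borel_measurable N \<Longrightarrow> (h :: 'a \<Rightarrow> ennreal) \<in> borel_measurable (\<mu> L)"
    and null_leaf: "Z \<in> null_sets M \<Longrightarrow> almost_every_leaf M F (\<lambda>L. Z \<inter> L \<in> null_sets (\<mu> L))"
    and infinite_leaf: "h \<in> borel_measurable N \<Longrightarrow>
      \<Union>{L \<in> F. (\<integral>\<^sup>+ x. h x \<partial>\<mu> L) = \<infinity>} \<in> sets M"
begin

section \<open>Admissible functions of an abstract family of leaves\<close>

lemma space_M: "space M = UNIV"
  by (simp add: M_completion space_N)

lemma AE_leaf:
  assumes "AE x in M. P x"
  shows "almost_every_leaf M F (\<lambda>L. AE x in \<mu> L. P x)"
proof -
  obtain Z where Z: "{x. \<not> P x} \<subseteq> Z" "Z \<in> null_sets M"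
    using assms by (auto simp: eventually_ae_filter space_M)
  show ?thesis
    unfolding M_completion
  proof (rule almost_every_leaf_mono[OF null_leaf[OF Z(2), unfolded M_completion]])
    fix L assume "L \<in> F" "Z \<inter> L \<in> null_sets (\<mu> L)"
    then show "AE x in \<mu> L. P x"
      using Z(1) by (intro AE_I'[of "Z \<inter> L"]) (auto simp: space_leaf)
  qed
qed

lemma adm_cong_AE:
  assumes f: "f \<in> adm p M \<mu> F" and g: "g \<in> borel_measurable M" "\<And>x. 0 \<le> g x"
    and eq: "AE x in M. f x = g x"
  shows "g \<in> adm p M \<mu> F"
proof -
  have "almost_every_leaf M F (\<lambda>L. 1 \<le> (\<integral>\<^sup>+ x. ennreal (f x) \<partial>\<mu> L) \<and> (AE x in \<mu> L. f x = g x))"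
    using f AE_leaf[OF eq] by (auto simp: adm_def M_completion intro: almost_every_leaf_conj)
  then have "almost_every_leaf M F (\<lambda>L. 1 \<le> (\<integral>\<^sup>+ x. ennreal (g x) \<partial>\<mu> L))"
    unfolding M_completion
  proof (rule almost_every_leaf_mono)
    fix L assume *: "1 \<le> (\<integral>\<^sup>+ x. ennreal (f x) \<partial>\<mu> L) \<and> (AE x in \<mu> L. f x = g x)"
    then have "(\<integral>\<^sup>+ x. ennreal (f x) \<partial>\<mu> L) = (\<integral>\<^sup>+ x. ennreal (g x) \<partial>\<mu> L)"
      by (intro nn_integral_cong_AE) auto
    with * show "1 \<le> (\<integral>\<^sup>+ x. ennreal (g x) \<partial>\<mu> L)" by simp
  qed
  then show ?thesis using f g eq by (auto simp: adm_def intro: Lp_space_cong_AE)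
qed

text \<open>An \<open>N\<close>-measurable representative restricts measurably to every leaf, so
  that leaf integrals of sums and multiples can be split.\<close>

lemma adm_representative:
  assumes f: "f \<in> adm p M \<mu> F"
  obtains g where "g \<in> adm p M \<mu> F" "g \<in> borel_measurable N" "energy p M g = energy p M f"
proof -
  have fM: "f \<in> borel_measurable M" and f0: "\<And>x. 0 \<le> f x" using f by (auto simp: adm_def Lp_space_def)
  obtain g where g: "g \<in> borel_measurable N" "AE x in N. f x = g x"
    using completion_ex_borel_measurable_real fM unfolding M_completion by blast
  \<comment> \<open>The representative agrees with \<open>f\<close> only almost everywhere, whereas
    \<open>adm\<close> demands nonnegativity at every point.\<close>
  define h where "h x = max 0 (g x)" for x
  have hN: "h \<in> borel_measurable N" using g(1) unfolding h_def by measurable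
  have hM: "h \<in> borel_measurable M" using hN by (simp add: M_completion measurable_completion)
  have eq: "AE x in M. f x = h x"
    unfolding M_completion using AE_completion[OF g(2)] by eventually_elim (metis f0 h_def max.absorb2)
  show ?thesis
    by (rule that[OF adm_cong_AE[OF f hM _ eq] hN energy_cong_AE[OF hM fM]])
       (use eq in \<open>auto simp: h_def elim: eventually_mono\<close>)
qed

text \<open>Leaf integrals average, and \<open>powr_midpoint_le\<close> keeps the midpoint in L^p.
  This convexity makes the energy of a midpoint comparable with the infimum.\<close>

lemma adm_midpoint:
  assumes p: "1 < p" and f: "f \<in> adm p M \<mu> F" "f \<in> borel_measurable N"
    and g: "g \<in> adm p M \<mu> F" "g \<in> borel_measurable N"
  shows "(\<lambda>x. (f x + g x) / 2) \<in> adm p M \<mu> F"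
proof -
  have f0: "\<And>x. 0 \<le> f x" and g0: "\<And>x. 0 \<le> g x" using f g by (auto simp: adm_def)
  have fg: "integrable M (\<lambda>x. \<bar>f x\<bar> powr p)" "integrable M (\<lambda>x. \<bar>g x\<bar> powr p)"
    "f \<in> borel_measurable M" "g \<in> borel_measurable M"
    using f g by (auto simp: adm_def Lp_space_def)
  have "integrable M (\<lambda>x. \<bar>(f x + g x) / 2\<bar> powr p)"
  proof (rule Bochner_Integration.integrable_bound)
    show "integrable M (\<lambda>x. (\<bar>f x\<bar> powr p + \<bar>g x\<bar> powr p) / 2)" using fg by auto
    show "AE x in M. norm (\<bar>(f x + g x) / 2\<bar> powr p) \<le> norm ((\<bar>f x\<bar> powr p + \<bar>g x\<bar> powr p) / 2)"
      using powr_midpoint_le[OF p f0 g0] f0 g0 by (auto intro!: AE_I2)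
  qed (use fg in measurable)
  moreover have "almost_every_leaf M F (\<lambda>L. 1 \<le> (\<integral>\<^sup>+ x. ennreal ((f x + g x) / 2) \<partial>\<mu> L))"
  proof -
    have "almost_every_leaf M F (\<lambda>L. 1 \<le> (\<integral>\<^sup>+ x. ennreal (f x) \<partial>\<mu> L) \<and> 1 \<le> (\<integral>\<^sup>+ x. ennreal (g x) \<partial>\<mu> L))"
      using f g unfolding M_completion by (intro almost_every_leaf_conj) (auto simp: adm_def)
    then show ?thesis
      unfolding M_completion
    proof (rule almost_every_leaf_mono)
      fix L assume L: "L \<in> F" and *: "1 \<le> (\<integral>\<^sup>+ x. ennreal (f x) \<partial>\<mu> L) \<and> 1 \<le> (\<integral>\<^sup>+ x. ennreal (g x) \<partial>\<mu> L)"
      have m: "(\<lambda>x. ennreal (f x)) \<in> borel_measurable (\<mu> L)" "(\<lambda>x. ennreal (g x)) \<in> borel_measurable (\<mu> L)"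
        using f g by (auto intro!: measurable_leaf[OF L])
      have "(\<integral>\<^sup>+ x. ennreal ((f x + g x) / 2) \<partial>\<mu> L) =
        (\<integral>\<^sup>+ x. ennreal (1 / 2) * (ennreal (f x) + ennreal (g x)) \<partial>\<mu> L)"
      proof (rule nn_integral_cong)
        fix x
        have "ennreal ((f x + g x) / 2) = ennreal (1 / 2 * (f x + g x))" by simp
        also have "\<dots> = ennreal (1 / 2) * ennreal (f x + g x)"
          using f0 g0 by (intro ennreal_mult) auto
        also have "ennreal (f x + g x) = ennreal (f x) + ennreal (g x)"
          using f0 g0 by (intro ennreal_plus) auto
        finally show "ennreal ((f x + g x) / 2) = ennreal (1 / 2) * (ennreal (f x) + ennreal (g x))" .
      qed
      also have "\<dots> = ennreal (1 / 2) * ((\<integral>\<^sup>+ x. ennreal (f x) \<partial>\<mu> L) + (\<integral>\<^sup>+ x. ennreal (g x) \<partial>\<mu> L))"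
        using m by (subst nn_integral_cmult) (auto simp: nn_integral_add)
      also have "\<dots> \<ge> ennreal (1 / 2) * (1 + 1)"
        using * by (intro mult_left_mono add_mono) auto
      also have "ennreal (1 / 2) * (1 + 1) = 1"
      proof -
        have "ennreal (1 / 2) * (1 + 1) = ennreal (1 / 2) * ennreal 2" by simp
        also have "\<dots> = ennreal (1 / 2 * 2)" by (rule ennreal_mult[symmetric]) auto
        finally show ?thesis by simp
      qed
      finally show "1 \<le> (\<integral>\<^sup>+ x. ennreal ((f x + g x) / 2) \<partial>\<mu> L)" .
    qed
  qed
  ultimately show ?thesis using fg f0 g0 by (auto simp: adm_def Lp_space_def)
qed

text \<open>Every positive multiple of \<open>H\<close> still has infinite integral on the
  exceptional leaves, hence is admissible for them, and its norm is as small as desired. Their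
  family thus has modulus 0, and \<open>pos\<close> rules out positive measure.\<close>

lemma almost_every_leaf_finite:
  assumes p: "1 < p"
    and pos: "\<And>\<L>. \<L> \<subseteq> F \<Longrightarrow> \<Union>\<L> \<in> sets M \<Longrightarrow> 0 < emeasure M (\<Union>\<L>) \<Longrightarrow> 0 < modulus p M \<mu> \<L>"
    and H: "H \<in> Lp_space p M" "H \<in> borel_measurable N" "\<And>x. 0 \<le> H x"
  shows "almost_every_leaf M F (\<lambda>L. (\<integral>\<^sup>+ x. ennreal (H x) \<partial>\<mu> L) \<noteq> \<infinity>)"
proof -
  define E where "E = {L \<in> F. (\<integral>\<^sup>+ x. ennreal (H x) \<partial>\<mu> L) = \<infinity>}"
  have EM: "\<Union>E \<in> sets M" unfolding E_def using H(2) by (intro infinite_leaf) measurable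
  have adm: "(\<lambda>x. c * H x) \<in> adm p M \<mu> E" if c: "0 < c" for c
  proof -
    have "(\<integral>\<^sup>+ x. ennreal (c * H x) \<partial>\<mu> L) = \<infinity>" if "L \<in> E" for L
    proof -
      have L: "L \<in> F" "(\<integral>\<^sup>+ x. ennreal (H x) \<partial>\<mu> L) = \<infinity>" using that by (auto simp: E_def)
      have "(\<integral>\<^sup>+ x. ennreal (c * H x) \<partial>\<mu> L) = (\<integral>\<^sup>+ x. ennreal c * ennreal (H x) \<partial>\<mu> L)"
        using c H(3) by (simp add: ennreal_mult)
      also have "\<dots> = ennreal c * (\<integral>\<^sup>+ x. ennreal (H x) \<partial>\<mu> L)"
        using H(2) by (intro nn_integral_cmult measurable_leaf[OF L(1)]) measurable
      finally show ?thesis using L(2) c by (simp add: ennreal_mult_top)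
    qed
    then have "{L \<in> E. \<not> 1 \<le> (\<integral>\<^sup>+ x. ennreal (c * H x) \<partial>\<mu> L)} = {}" by auto
    then have "almost_every_leaf M E (\<lambda>L. 1 \<le> (\<integral>\<^sup>+ x. ennreal (c * H x) \<partial>\<mu> L))"
      by (simp only: almost_every_leaf_def Union_empty null_sets.empty_sets)
    then show ?thesis
      using c H Lp_space_scale[of c H p M] by (auto simp: adm_def)
  qed
  have le: "modulus p M \<mu> E \<le> ennreal (c * Lp_norm p M H)" if "0 < c" for c
  proof -
    have "(INF f\<in>adm p M \<mu> E. ennreal (Lp_norm p M f)) \<le> ennreal (Lp_norm p M (\<lambda>x. c * H x))"
      using adm[OF that] by (rule INF_lower)
    then show ?thesis using adm[OF that] that p by (auto simp: modulus_def Lp_norm_scale)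
  qed
  have n0: "0 \<le> Lp_norm p M H" by (simp add: Lp_norm_def)
  have "modulus p M \<mu> E \<le> ennreal e" if e: "0 < e" for e
  proof -
    \<comment> \<open>Adding 1 to the norm keeps the scaling factor positive when \<open>H\<close>
      has norm 0.\<close>
    have "modulus p M \<mu> E \<le> ennreal (e / (Lp_norm p M H + 1) * Lp_norm p M H)"
      using e n0 by (intro le) auto
    also have "\<dots> \<le> ennreal e"
      using e n0 by (intro ennreal_leI) (simp add: field_simps)
    finally show ?thesis .
  qed
  then have "modulus p M \<mu> E = 0"
    using ennreal_le_epsilon[of 0 "modulus p M \<mu> E"] by (simp add: le_zero_eq)
  then have "emeasure M (\<Union>E) = 0"
    using pos[of E] EM by (auto simp: E_def zero_less_iff_neq_zero)
  then show ?thesis using EM by (simp add: almost_every_leaf_def E_def null_sets_def)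
qed

lemma modulus_pos_if_extremal:
  assumes p: "1 < p" and ext: "extremal p M \<mu> F f0"
    and sub: "\<L> \<subseteq> F" and meas: "\<Union>\<L> \<in> sets M" and pos: "0 < emeasure M (\<Union>\<L>)"
  shows "0 < modulus p M \<mu> \<L>"
proof (rule ccontr)
  assume "\<not> 0 < modulus p M \<mu> \<L>"
  then have zero: "modulus p M \<mu> \<L> = 0" by (simp add: zero_less_iff_neq_zero)
  define U where "U = \<Union>\<L>"
  have UM [measurable]: "U \<in> sets M" using meas by (simp add: U_def)
  have f0: "f0 \<in> adm p M \<mu> F" "\<And>f. f \<in> adm p M \<mu> F \<Longrightarrow> Lp_norm p M f0 \<le> Lp_norm p M f"
  proof -
    show *: "f0 \<in> adm p M \<mu> F" using ext by (simp add: extremal_def)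
    fix f assume f: "f \<in> adm p M \<mu> F"
    have "ennreal (Lp_norm p M f0) \<le> ennreal (Lp_norm p M f)"
      using ext f by (auto simp: extremal_def modulus_def split: if_splits intro: INF_lower2 dest!: sym[of _ "ennreal _"])
    then show "Lp_norm p M f0 \<le> Lp_norm p M f" by (simp add: Lp_norm_def)
  qed
  have [measurable]: "f0 \<in> borel_measurable M" and f0i: "integrable M (\<lambda>x. \<bar>f0 x\<bar> powr p)"
    and f0n: "\<And>x. 0 \<le> f0 x"
    using f0(1) by (auto simp: adm_def Lp_space_def)
  define a where "a = (\<integral>x. indicator U x * \<bar>f0 x\<bar> powr p \<partial>M)"
  have ai: "integrable M (\<lambda>x. indicator U x * \<bar>f0 x\<bar> powr p)"
    using integrable_mult_indicator[OF UM f0i] by simp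
  have bound: "a \<le> energy p M f" if f: "f \<in> adm p M \<mu> \<L>" for f
  proof -
    have [measurable]: "f \<in> borel_measurable M" and fi: "integrable M (\<lambda>x. \<bar>f x\<bar> powr p)"
      and fn: "\<And>x. 0 \<le> f x"
      using f by (auto simp: adm_def Lp_space_def)
    \<comment> \<open>Leaves are disjoint, so a leaf of \<L> lies in \<open>U\<close> and any other
      leaf misses it: on each leaf \<open>h\<close> is either \<open>f\<close> or \<open>f0\<close>,
      which makes it admissible for \<open>F\<close>.\<close>
    define h where "h x = (if x \<in> U then f x else f0 x)" for x
    have h_powr: "\<bar>h x\<bar> powr p = indicator U x * \<bar>f x\<bar> powr p + (\<bar>f0 x\<bar> powr p - indicator U x * \<bar>f0 x\<bar> powr p)" for x
      by (simp add: h_def)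
    have fU: "integrable M (\<lambda>x. indicator U x * \<bar>f x\<bar> powr p)"
      using integrable_mult_indicator[OF UM fi] by simp
    have hi: "integrable M (\<lambda>x. \<bar>h x\<bar> powr p)" unfolding h_powr using fU ai f0i by auto
    have hm: "h \<in> borel_measurable M" unfolding h_def by measurable
    have "almost_every_leaf M F (\<lambda>L. 1 \<le> (\<integral>\<^sup>+ x. ennreal (h x) \<partial>\<mu> L))"
      unfolding almost_every_leaf_def
    proof (rule null_sets_completion_subset[of _ _ N, folded M_completion])
      let ?B = "\<Union>{L \<in> F. \<not> 1 \<le> (\<integral>\<^sup>+ x. ennreal (f0 x) \<partial>\<mu> L)} \<union> \<Union>{L \<in> \<L>. \<not> 1 \<le> (\<integral>\<^sup>+ x. ennreal (f x) \<partial>\<mu> L)}"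
      show "?B \<in> null_sets M"
        using f0(1) f by (auto simp: adm_def almost_every_leaf_def)
      have hL: "(\<integral>\<^sup>+ x. ennreal (h x) \<partial>\<mu> L) = (\<integral>\<^sup>+ x. ennreal (if L \<in> \<L> then f x else f0 x) \<partial>\<mu> L)" if "L \<in> F" for L
        by (rule nn_integral_cong) (use that sub leaves_disjoint in \<open>auto simp: space_leaf h_def U_def\<close>)
      show "\<Union>{L \<in> F. \<not> 1 \<le> (\<integral>\<^sup>+ x. ennreal (h x) \<partial>\<mu> L)} \<subseteq> ?B"
      proof
        fix x assume "x \<in> \<Union>{L \<in> F. \<not> 1 \<le> (\<integral>\<^sup>+ x. ennreal (h x) \<partial>\<mu> L)}"
        then obtain L where "L \<in> F" "x \<in> L" "\<not> 1 \<le> (\<integral>\<^sup>+ x. ennreal (h x) \<partial>\<mu> L)" by blast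
        then show "x \<in> ?B" using hL[of L] by (cases "L \<in> \<L>") auto
      qed
    qed
    then have "h \<in> adm p M \<mu> F"
      using hi hm fn f0n by (auto simp: adm_def Lp_space_def h_def)
    from f0(2)[OF this] have "energy p M f0 \<le> energy p M h"
      using p powr_less_mono2[of "1 / p" "energy p M h" "energy p M f0"]
      by (fastforce simp: Lp_norm_energy energy_nonneg intro: leI dest: leD)
    \<comment> \<open>Off \<open>U\<close> the functions \<open>h\<close> and \<open>f0\<close>
      agree, so minimality of \<open>f0\<close> becomes a comparison on \<open>U\<close>
      alone.\<close>
    also have "energy p M h = (\<integral>x. indicator U x * \<bar>f x\<bar> powr p \<partial>M) + (energy p M f0 - a)"
      unfolding energy_def h_powr a_def using fU ai f0i by simp
    finally have "a \<le> (\<integral>x. indicator U x * \<bar>f x\<bar> powr p \<partial>M)" by simp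
    also have "\<dots> \<le> energy p M f"
      unfolding energy_def by (intro integral_mono fU fi) (auto simp: indicator_def)
    finally show ?thesis .
  qed
  have a0: "a = 0"
  proof (rule ccontr)
    assume "a \<noteq> 0"
    moreover have "0 \<le> a" by (simp add: a_def)
    ultimately have a: "0 < a" by simp
    \<comment> \<open>This bound also covers an empty \<open>adm\<close>, whose modulus is
      infinite.\<close>
    have "ennreal (a powr (1 / p)) \<le> modulus p M \<mu> \<L>"
      unfolding modulus_def using bound p a
      by (auto intro!: INF_greatest ennreal_leI powr_mono2 simp: Lp_norm_energy)
    then show False using zero a by simp
  qed
  have "AE x in M. indicator U x * \<bar>f0 x\<bar> powr p = 0"
    using a0 integral_nonneg_eq_0_iff_AE[OF ai] by (simp add: a_def)
  then have "AE x in M. x \<in> U \<longrightarrow> f0 x = 0"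
    by eventually_elim (auto simp: indicator_def split: if_splits)
  from AE_leaf[OF this] have "almost_every_leaf M F (\<lambda>L. 1 \<le> (\<integral>\<^sup>+ x. ennreal (f0 x) \<partial>\<mu> L) \<and> (AE x in \<mu> L. x \<in> U \<longrightarrow> f0 x = 0))"
    using f0(1) unfolding M_completion by (intro almost_every_leaf_conj) (auto simp: adm_def)
  \<comment> \<open>A leaf of \<L> satisfying both conditions would have an integral that is 0 and
    at least 1.\<close>
  then have "almost_every_leaf M F (\<lambda>L. L \<notin> \<L>)"
    unfolding M_completion
  proof (rule almost_every_leaf_mono, intro notI)
    fix L assume L: "L \<in> F" "L \<in> \<L>"
      and *: "1 \<le> (\<integral>\<^sup>+ x. ennreal (f0 x) \<partial>\<mu> L) \<and> (AE x in \<mu> L. x \<in> U \<longrightarrow> f0 x = 0)"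
    have "AE x in \<mu> L. f0 x = 0"
      using AE_space conjunct2[OF *] by eventually_elim (use L in \<open>auto simp: U_def space_leaf\<close>)
    then have "(\<integral>\<^sup>+ x. ennreal (f0 x) \<partial>\<mu> L) = (\<integral>\<^sup>+ x. 0 \<partial>\<mu> L)"
      by (intro nn_integral_cong_AE) auto
    with * show False by simp
  qed
  then have "U \<in> null_sets M"
    unfolding almost_every_leaf_def M_completion
    by (rule null_sets_completion_subset[rotated]) (use sub in \<open>auto simp: U_def\<close>)
  then show False using pos by (auto simp: U_def)
qed

text \<open>The midpoint of two near minimizers is admissible, so its energy is at least
  \<open>I\<close> and the integrated midpoint deficit is at most \<open>\<delta>\<close>. The
  quantitative convexity estimate converts this into closeness of the two functions.\<close>

lemma near_minimizers_close:
  assumes p: "1 < p" and I: "0 \<le> I" "\<And>f. f \<in> adm p M \<mu> F \<Longrightarrow> I \<le> energy p M f" and eta: "0 < \<eta>"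
  shows "\<exists>\<delta>>0. \<forall>f g. f \<in> adm p M \<mu> F \<and> f \<in> borel_measurable N \<and> energy p M f < I + \<delta> \<and>
    g \<in> adm p M \<mu> F \<and> g \<in> borel_measurable N \<and> energy p M g < I + \<delta> \<longrightarrow>
    integrable M (\<lambda>x. \<bar>f x - g x\<bar> powr p) \<and> energy p M (\<lambda>x. f x - g x) \<le> \<eta>"
proof -
  \<comment> \<open>Both energies will be below \<open>I + 1\<close>, so the term with
    \<open>e\<close> contributes at most half of \<open>\<eta>\<close>.\<close>
  define e where "e = \<eta> / (4 * (I + 1))"
  have e: "0 < e" using eta I by (simp add: e_def)
  obtain C where C: "0 \<le> C" "\<And>a b. 0 \<le> a \<Longrightarrow> 0 \<le> b \<Longrightarrow> \<bar>a - b\<bar> powr p \<le>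
       e * (a powr p + b powr p) + C * ((a powr p + b powr p) / 2 - ((a + b) / 2) powr p)"
    using powr_diff_le_midpoint_deficit[OF p e] by blast
  \<comment> \<open>The cap 1 yields the bound \<open>I + 1\<close> on the energies;
    \<open>C + 1\<close> keeps the quotient positive when \<open>C = 0\<close>.\<close>
  define \<delta> where "\<delta> = min 1 (\<eta> / (2 * (C + 1)))"
  have \<delta>: "0 < \<delta>" "\<delta> \<le> 1" "(C + 1) * \<delta> \<le> \<eta> / 2"
  proof -
    show "0 < \<delta>" "\<delta> \<le> 1" using eta C by (auto simp: \<delta>_def)
    have "(C + 1) * \<delta> \<le> (C + 1) * (\<eta> / (2 * (C + 1)))"
      using C(1) by (intro mult_left_mono) (auto simp: \<delta>_def)
    also have "\<dots> = \<eta> / 2" using C(1) by (simp add: divide_simps)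
    finally show "(C + 1) * \<delta> \<le> \<eta> / 2" .
  qed
  show ?thesis
  proof (intro exI[of _ \<delta>] conjI allI impI \<delta>(1); elim conjE)
    fix f g
    assume f: "f \<in> adm p M \<mu> F" "f \<in> borel_measurable N" "energy p M f < I + \<delta>"
      and g: "g \<in> adm p M \<mu> F" "g \<in> borel_measurable N" "energy p M g < I + \<delta>"
    define m where "m x = (f x + g x) / 2" for x
    have m: "m \<in> adm p M \<mu> F" unfolding m_def using adm_midpoint[OF p f(1,2) g(1,2)] .
    have n: "\<And>x. 0 \<le> f x" "\<And>x. 0 \<le> g x" "\<And>x. 0 \<le> m x" using f g m by (auto simp: adm_def)
    have i: "integrable M (\<lambda>x. f x powr p)" "integrable M (\<lambda>x. g x powr p)" "integrable M (\<lambda>x. m x powr p)"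
      and [measurable]: "f \<in> borel_measurable M" "g \<in> borel_measurable M"
      using f g m n by (auto simp: adm_def Lp_space_def)
    let ?R = "\<lambda>x. e * (f x powr p + g x powr p) + C * ((f x powr p + g x powr p) / 2 - m x powr p)"
    have R: "integrable M ?R" using i by auto
    have le: "\<bar>f x - g x\<bar> powr p \<le> ?R x" for x
      using C(2)[OF n(1) n(2)] by (simp add: m_def)
    have R0: "0 \<le> ?R x" for x using le[of x] order_trans[OF powr_ge_zero] by blast
    show fgi: "integrable M (\<lambda>x. \<bar>f x - g x\<bar> powr p)"
      by (rule Bochner_Integration.integrable_bound[OF R]) (use le R0 in \<open>auto intro!: AE_I2\<close>)
    have "energy p M (\<lambda>x. f x - g x) \<le> (\<integral>x. ?R x \<partial>M)"
      unfolding energy_def by (intro integral_mono fgi R le)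
    also have "\<dots> = e * (energy p M f + energy p M g) + C * ((energy p M f + energy p M g) / 2 - energy p M m)"
      using i n by (simp add: energy_def)
    also have "\<dots> \<le> e * (2 * (I + 1)) + C * \<delta>"
    proof (intro add_mono mult_left_mono)
      show "(energy p M f + energy p M g) / 2 - energy p M m \<le> \<delta>"
        using f(3) g(3) I(2)[OF m] by (simp add: field_simps)
    qed (use f(3) g(3) \<delta> e C in auto)
    also have "\<dots> \<le> \<eta> / 2 + \<eta> / 2"
    proof (rule add_mono)
      show "e * (2 * (I + 1)) \<le> \<eta> / 2" using I(1) by (simp add: e_def field_simps)
      show "C * \<delta> \<le> \<eta> / 2" using \<delta> by (simp add: algebra_simps)
    qed
    finally show "energy p M (\<lambda>x. f x - g x) \<le> \<eta>" by simp
  qed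
qed

text \<open>The sequence is chosen fast enough from the start that a dominating geometric series
  yields its pointwise limit; Fatou's lemma then bounds the energy of the limit.\<close>

lemma ex_extremal:
  assumes p: "1 < p" and nonempty: "adm p M \<mu> F \<noteq> {}"
    and pos: "\<And>\<L>. \<L> \<subseteq> F \<Longrightarrow> \<Union>\<L> \<in> sets M \<Longrightarrow> 0 < emeasure M (\<Union>\<L>) \<Longrightarrow> 0 < modulus p M \<mu> \<L>"
  shows "\<exists>f0. extremal p M \<mu> F f0"
proof -
  define I where "I = Inf (energy p M ` adm p M \<mu> F)"
  have bdd: "bdd_below (energy p M ` adm p M \<mu> F)"
    by (rule bdd_belowI[of _ 0]) (auto simp: energy_nonneg)
  have I_le: "I \<le> energy p M f" if "f \<in> adm p M \<mu> F" for f
    unfolding I_def using that bdd by (intro cInf_lower) auto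
  have I0: "0 \<le> I" unfolding I_def using nonempty by (intro cInf_greatest) (auto simp: energy_nonneg)
  have near: "\<exists>f. f \<in> adm p M \<mu> F \<and> f \<in> borel_measurable N \<and> energy p M f < I + d" if d: "0 < d" for d
  proof -
    have "\<exists>y\<in>energy p M ` adm p M \<mu> F. y < I + d"
      using nonempty d by (intro cInf_lessD) (auto simp: I_def)
    then obtain f where f: "f \<in> adm p M \<mu> F" "energy p M f < I + d" by auto
    then show ?thesis using adm_representative[OF f(1)] by metis
  qed
  \<comment> \<open>Chosen so that \<open>(2 ^ k) powr p * \<eta> k = (1 / 2) ^ k\<close>: the
    differences stay summable after the weighting in \<open>G\<close>.\<close>
  define \<eta> where "\<eta> k = (1 / 2) ^ k / (2 ^ k) powr p" for k :: nat
  have \<eta>: "0 < \<eta> k" for k by (simp add: \<eta>_def)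
  have "\<forall>k. \<exists>\<delta>>0. \<forall>f g. f \<in> adm p M \<mu> F \<and> f \<in> borel_measurable N \<and> energy p M f < I + \<delta> \<and>
    g \<in> adm p M \<mu> F \<and> g \<in> borel_measurable N \<and> energy p M g < I + \<delta> \<longrightarrow>
    integrable M (\<lambda>x. \<bar>f x - g x\<bar> powr p) \<and> energy p M (\<lambda>x. f x - g x) \<le> \<eta> k"
    using near_minimizers_close[OF p I0 I_le \<eta>] by blast
  then obtain \<delta> where \<delta>: "\<And>k. 0 < \<delta> k"
    and close: "\<And>k f g. f \<in> adm p M \<mu> F \<Longrightarrow> f \<in> borel_measurable N \<Longrightarrow> energy p M f < I + \<delta> k \<Longrightarrow>
    g \<in> adm p M \<mu> F \<Longrightarrow> g \<in> borel_measurable N \<Longrightarrow> energy p M g < I + \<delta> k \<Longrightarrow>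
    integrable M (\<lambda>x. \<bar>f x - g x\<bar> powr p) \<and> energy p M (\<lambda>x. f x - g x) \<le> \<eta> k"
    unfolding choice_iff by blast
  \<comment> \<open>The minimum over \<open>{..k}\<close> brings both \<open>f k\<close> and
    \<open>f (Suc k)\<close> within \<open>\<delta> k\<close> of the infimum; the bound
    \<open>1 / real (Suc k)\<close> makes the energies converge to \<open>I\<close>.\<close>
  have "\<forall>k. \<exists>f. f \<in> adm p M \<mu> F \<and> f \<in> borel_measurable N \<and>
      energy p M f < I + min (Min (\<delta> ` {..k})) (1 / real (Suc k))"
    using \<delta> by (intro allI near) (auto simp: Min_gr_iff)
  then obtain f where f: "\<And>k. f k \<in> adm p M \<mu> F" and fN [measurable]: "\<And>k. f k \<in> borel_measurable N"
    and fI: "\<And>k. energy p M (f k) < I + min (Min (\<delta> ` {..k})) (1 / real (Suc k))"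
    unfolding choice_iff by blast
  have fM [measurable]: "f k \<in> borel_measurable M" for k
    using fN by (simp add: M_completion measurable_completion)
  have f0: "0 \<le> f k x" for k x using f by (auto simp: adm_def)
  have f_delta: "energy p M (f k) < I + \<delta> j" if "j \<le> k" for j k
  proof -
    have "Min (\<delta> ` {..k}) \<le> \<delta> j" using that by (intro Min_le) auto
    then show ?thesis using fI[of k] by linarith
  qed
  have f_I: "energy p M (f k) < I + 1 / real (Suc k)" for k using fI[of k] by linarith
  define d where "d k x = \<bar>f (Suc k) x - f k x\<bar>" for k x
  have d: "integrable M (\<lambda>x. d k x powr p)" "(\<integral>x. d k x powr p \<partial>M) \<le> \<eta> k" for k
    using close[OF f fN f_delta f fN f_delta, of k "Suc k" k] by (auto simp: d_def energy_def)
  have [measurable]: "d k \<in> borel_measurable N" "d k \<in> borel_measurable M" for k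
    unfolding d_def by measurable
  text \<open>Summing powers with growing weights makes \<open>G\<close> integrable and still dominates every
    difference geometrically, which avoids Minkowski's inequality.\<close>
  define G where "G x = (\<Sum>k. ennreal ((2 ^ k * d k x) powr p))" for x
  have GN [measurable]: "G \<in> borel_measurable N" unfolding G_def by measurable
  have GM [measurable]: "G \<in> borel_measurable M" unfolding G_def by measurable
  have "(\<integral>\<^sup>+ x. G x \<partial>M) = (\<Sum>k. \<integral>\<^sup>+ x. ennreal ((2 ^ k * d k x) powr p) \<partial>M)"
    unfolding G_def by (intro nn_integral_suminf) measurable
  also have "\<dots> \<le> (\<Sum>k. ennreal ((1 / 2) ^ k))"
  proof (intro suminf_le summableI)
    fix k
    have "(\<integral>\<^sup>+ x. ennreal ((2 ^ k * d k x) powr p) \<partial>M) = ennreal (\<integral>x. (2 ^ k) powr p * d k x powr p \<partial>M)"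
      using d(1)[of k] by (subst nn_integral_eq_integral) (auto simp: powr_mult)
    also have "\<dots> = ennreal ((2 ^ k) powr p * (\<integral>x. d k x powr p \<partial>M))" by simp
    also have "\<dots> \<le> ennreal ((2 ^ k) powr p * \<eta> k)"
      using d(2)[of k] by (intro ennreal_leI mult_left_mono) auto
    finally show "(\<integral>\<^sup>+ x. ennreal ((2 ^ k * d k x) powr p) \<partial>M) \<le> ennreal ((1 / 2) ^ k)"
      by (simp add: \<eta>_def)
  qed
  also have "\<dots> = ennreal 2"
    using geometric_sums[of "1 / 2 :: real"] by (intro suminf_ennreal_eq) auto
  finally have Gint: "(\<integral>\<^sup>+ x. G x \<partial>M) \<le> ennreal 2" .
  then have Gfin: "AE x in M. G x \<noteq> \<infinity>"
    by (intro nn_integral_noteq_infinite) (auto simp: top_unique)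
  \<comment> \<open>The \<open>p\<close>-th root of \<open>G\<close>, so that \<open>H\<close> lies
    in L^p. Where \<open>G\<close> is infinite \<open>enn2real\<close> gives 0, hence bounds by
    \<open>H\<close> are claimed only where \<open>G\<close> is finite.\<close>
  define H where "H x = enn2real (G x) powr (1 / p)" for x
  have H0: "0 \<le> H x" for x by (simp add: H_def)
  have HN [measurable]: "H \<in> borel_measurable N" and HM [measurable]: "H \<in> borel_measurable M"
    unfolding H_def by measurable
  have "integrable M (\<lambda>x. enn2real (G x))"
  proof (rule integrableI_nonneg)
    have "(\<integral>\<^sup>+ x. ennreal (enn2real (G x)) \<partial>M) \<le> (\<integral>\<^sup>+ x. G x \<partial>M)"
      by (intro nn_integral_mono) (simp add: ennreal_enn2real_if)
    also have "\<dots> < \<infinity>" using Gint by (simp add: le_less_trans)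
    finally show "(\<integral>\<^sup>+ x. ennreal (enn2real (G x)) \<partial>M) < \<infinity>" .
  qed auto
  then have HL: "H \<in> Lp_space p M"
    using p by (auto simp: Lp_space_def H_def powr_powr)
  \<comment> \<open>A single term of the series is at most \<open>G\<close>; taking
    \<open>p\<close>-th roots gives \<open>2 ^ k * d k x \<le> H x\<close>.\<close>
  have d_le: "d k x \<le> H x * (1 / 2) ^ k" if "G x \<noteq> \<infinity>" for k x
  proof -
    have "u k \<le> suminf u" for u :: "nat \<Rightarrow> ennreal"
      using sum_le_suminf[OF summableI, of "{k}" u] by simp
    from this[of "\<lambda>k. ennreal ((2 ^ k * d k x) powr p)"]
    have "ennreal ((2 ^ k * d k x) powr p) \<le> G x" by (simp only: G_def)
    also have "G x = ennreal (enn2real (G x))" using that by (simp add: less_top)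
    finally have "(2 ^ k * d k x) powr p \<le> enn2real (G x)" by simp
    then have "((2 ^ k * d k x) powr p) powr (1 / p) \<le> H x"
      unfolding H_def using p by (intro powr_mono2) auto
    then have "2 ^ k * d k x \<le> H x" using p by (simp add: powr_powr d_def)
    then show ?thesis by (simp add: field_simps power_divide)
  qed
  \<comment> \<open>The value 0 on the null set where \<open>G\<close> is infinite keeps
    \<open>f'\<close> nonnegative everywhere, as \<open>adm\<close> demands.\<close>
  define f' where "f' x = (if G x = \<infinity> then 0 else lim (\<lambda>k. f k x))" for x
  have lim: "(\<lambda>k. f k x) \<longlonglongrightarrow> f' x" if "G x \<noteq> \<infinity>" for x
  proof -
    have "summable (\<lambda>k. f (Suc k) x - f k x)"
    proof (rule summable_comparison_test'[of "\<lambda>k. H x * (1 / 2) ^ k"])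
      show "norm (f (Suc k) x - f k x) \<le> H x * (1 / 2) ^ k" for k
        using d_le[OF that, of k] by (simp add: d_def)
    qed (intro summable_mult summable_geometric, simp)
    then have "(\<lambda>n. \<Sum>k<n. f (Suc k) x - f k x) \<longlonglongrightarrow> (\<Sum>k. f (Suc k) x - f k x)"
      by (rule summable_LIMSEQ)
    then have "(\<lambda>n. f n x - f 0 x) \<longlonglongrightarrow> (\<Sum>k. f (Suc k) x - f k x)"
      by (simp add: sum_lessThan_telescope[of "\<lambda>k. f k x"])
    then have "(\<lambda>n. (f n x - f 0 x) + f 0 x) \<longlonglongrightarrow> (\<Sum>k. f (Suc k) x - f k x) + f 0 x"
      by (intro tendsto_add tendsto_const)
    then have "convergent (\<lambda>n. f n x)" by (auto simp: convergent_def)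
    then show ?thesis using that by (simp add: f'_def convergent_LIMSEQ_iff)
  qed
  have f'0: "0 \<le> f' x" for x
  proof (cases "G x = \<infinity>")
    case False
    then show ?thesis using lim[OF False] f0 by (intro LIMSEQ_le_const) auto
  qed (simp add: f'_def)
  have f'M [measurable]: "f' \<in> borel_measurable M" and f'N [measurable]: "f' \<in> borel_measurable N"
    unfolding f'_def by measurable
  \<comment> \<open>The factor \<open>2 * (1 / 2) ^ k\<close> is the sum of the geometric series
    from \<open>k\<close> on. An upper bound on \<open>f k\<close> is the useful direction, since
    admissibility bounds leaf integrals from below.\<close>
  have f_le: "f k x \<le> f' x + 2 * (1 / 2) ^ k * H x" if "G x \<noteq> \<infinity>" for k x
  proof -
    \<comment> \<open>Retaining the subtracted tail lets the induction close exactly.\<close>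
    have step: "f k x \<le> f (k + m) x + 2 * (1 / 2) ^ k * H x - 2 * (1 / 2) ^ (k + m) * H x" for m
    proof (induction m)
      case (Suc m)
      have "f (k + m) x \<le> f (Suc (k + m)) x + H x * (1 / 2) ^ (k + m)"
        using d_le[OF that, of "k + m"] by (simp add: d_def)
      moreover have "2 * (1 / 2) ^ (k + Suc m) * H x = H x * (1 / 2) ^ (k + m)" by simp
      moreover have "2 * (1 / 2) ^ (k + m) * H x = 2 * (H x * (1 / 2) ^ (k + m))" by simp
      ultimately show ?case using Suc unfolding add_Suc_right by linarith
    qed simp
    have "f k x \<le> f (k + m) x + 2 * (1 / 2) ^ k * H x" for m
      using step[of m] H0[of x] by (smt (verit) mult_nonneg_nonneg zero_le_power divide_nonneg_nonneg)
    moreover have "(\<lambda>m. f (m + k) x + 2 * (1 / 2) ^ k * H x) \<longlonglongrightarrow> f' x + 2 * (1 / 2) ^ k * H x"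
      by (intro tendsto_intros LIMSEQ_ignore_initial_segment lim that)
    ultimately show ?thesis by (intro LIMSEQ_le_const) (auto simp: add.commute)
  qed
  have "(\<integral>\<^sup>+ x. ennreal (\<bar>f' x\<bar> powr p) \<partial>M) = (\<integral>\<^sup>+ x. liminf (\<lambda>k. ennreal (\<bar>f k x\<bar> powr p)) \<partial>M)"
  proof (rule nn_integral_cong_AE)
    show "AE x in M. ennreal (\<bar>f' x\<bar> powr p) = liminf (\<lambda>k. ennreal (\<bar>f k x\<bar> powr p))"
      using Gfin
    proof eventually_elim
      case (elim x)
      have "(\<lambda>k. ennreal (\<bar>f k x\<bar> powr p)) \<longlonglongrightarrow> ennreal (\<bar>f' x\<bar> powr p)"
        using p by (intro tendsto_ennrealI tendsto_powr' tendsto_rabs lim elim tendsto_const) auto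
      then show ?case by (intro lim_imp_Liminf[symmetric]) auto
    qed
  qed
  \<comment> \<open>Fatou's lemma: the energies converge to \<open>I\<close>, so the limit function
    has energy at most \<open>I\<close>.\<close>
  also have "\<dots> \<le> liminf (\<lambda>k. \<integral>\<^sup>+ x. ennreal (\<bar>f k x\<bar> powr p) \<partial>M)"
    by (intro nn_integral_liminf) measurable
  also have "(\<lambda>k. \<integral>\<^sup>+ x. ennreal (\<bar>f k x\<bar> powr p) \<partial>M) = (\<lambda>k. ennreal (energy p M (f k)))"
  proof
    fix k
    have "integrable M (\<lambda>x. \<bar>f k x\<bar> powr p)"
      using f[of k] unfolding adm_def Lp_space_def by blast
    then show "(\<integral>\<^sup>+ x. ennreal (\<bar>f k x\<bar> powr p) \<partial>M) = ennreal (energy p M (f k))"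
      unfolding energy_def by (intro nn_integral_eq_integral) auto
  qed
  also have "liminf (\<lambda>k. ennreal (energy p M (f k))) = ennreal I"
  proof (intro lim_imp_Liminf tendsto_ennrealI)
    show "(\<lambda>k. energy p M (f k)) \<longlonglongrightarrow> I"
    proof (rule tendsto_sandwich[of "\<lambda>_. I" _ _ "\<lambda>k. I + 1 / real (Suc k)"])
      show "(\<lambda>k. I + 1 / real (Suc k)) \<longlonglongrightarrow> I"
        using tendsto_add[OF tendsto_const LIMSEQ_inverse_real_of_nat, of I] by (simp add: inverse_eq_divide)
    qed (use I_le[OF f] f_I in \<open>auto intro!: always_eventually less_imp_le\<close>)
  qed simp
  finally have f'_int: "(\<integral>\<^sup>+ x. ennreal (\<bar>f' x\<bar> powr p) \<partial>M) \<le> ennreal I" .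
  have f'i: "integrable M (\<lambda>x. \<bar>f' x\<bar> powr p)"
    using f'_int by (intro integrableI_nonneg) (auto simp: le_less_trans)
  have f'_energy: "energy p M f' \<le> I"
    using f'_int I0 nn_integral_eq_integral[OF f'i] by (simp add: energy_def)
  \<comment> \<open>Countably many conditions, each with a null set of exceptional leaves. The
    hypothesis \<open>pos\<close> enters through the finiteness of the integral of
    \<open>H\<close>.\<close>
  have "almost_every_leaf M F (\<lambda>L. ((AE x in \<mu> L. G x \<noteq> \<infinity>) \<and> (\<integral>\<^sup>+ x. ennreal (H x) \<partial>\<mu> L) \<noteq> \<infinity>) \<and>
      (\<forall>k. 1 \<le> (\<integral>\<^sup>+ x. ennreal (f k x) \<partial>\<mu> L)))"
  proof -
    have "almost_every_leaf M F (\<lambda>L. 1 \<le> (\<integral>\<^sup>+ x. ennreal (f k x) \<partial>\<mu> L))" for k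
      using f[of k] unfolding adm_def by blast
    then show ?thesis
      using AE_leaf[OF Gfin] almost_every_leaf_finite[OF p pos HL HN H0]
      by (simp only: M_completion almost_every_leaf_conj almost_every_leaf_all_nat)
  qed
  then have "almost_every_leaf M F (\<lambda>L. 1 \<le> (\<integral>\<^sup>+ x. ennreal (f' x) \<partial>\<mu> L))"
    unfolding M_completion
  proof (rule almost_every_leaf_mono; elim conjE)
    fix L assume L: "L \<in> F" and fin: "AE x in \<mu> L. G x \<noteq> \<infinity>" "(\<integral>\<^sup>+ x. ennreal (H x) \<partial>\<mu> L) \<noteq> \<infinity>"
      and ge: "\<forall>k. 1 \<le> (\<integral>\<^sup>+ x. ennreal (f k x) \<partial>\<mu> L)"
    obtain J where J: "0 \<le> J" "(\<integral>\<^sup>+ x. ennreal (H x) \<partial>\<mu> L) = ennreal J"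
      using fin(2) by (metis ennreal_cases infinity_ennreal_def)
    have m: "(\<lambda>x. ennreal (f' x)) \<in> borel_measurable (\<mu> L)" "(\<lambda>x. ennreal (H x)) \<in> borel_measurable (\<mu> L)"
      by (auto intro!: measurable_leaf[OF L])
    \<comment> \<open>On such a leaf \<open>H\<close> has the finite integral \<open>J\<close>, so
      the error term vanishes as \<open>k\<close> grows.\<close>
    have key: "1 \<le> (\<integral>\<^sup>+ x. ennreal (f' x) \<partial>\<mu> L) + ennreal (2 * (1 / 2) ^ k * J)" for k
    proof -
      have "1 \<le> (\<integral>\<^sup>+ x. ennreal (f k x) \<partial>\<mu> L)" using ge by simp
      also have "\<dots> \<le> (\<integral>\<^sup>+ x. ennreal (f' x) + ennreal (2 * (1 / 2) ^ k) * ennreal (H x) \<partial>\<mu> L)"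
      proof (rule nn_integral_mono_AE)
        show "AE x in \<mu> L. ennreal (f k x) \<le> ennreal (f' x) + ennreal (2 * (1 / 2) ^ k) * ennreal (H x)"
          using fin(1)
        proof eventually_elim
          case (elim x)
          have "ennreal (f k x) \<le> ennreal (f' x + 2 * (1 / 2) ^ k * H x)"
            by (intro ennreal_leI f_le elim)
          also have "\<dots> = ennreal (f' x) + ennreal (2 * (1 / 2) ^ k) * ennreal (H x)"
            using f'0 H0 by (subst ennreal_plus) (auto intro!: ennreal_mult)
          finally show ?case .
        qed
      qed
      also have "\<dots> = (\<integral>\<^sup>+ x. ennreal (f' x) \<partial>\<mu> L) + ennreal (2 * (1 / 2) ^ k) * (\<integral>\<^sup>+ x. ennreal (H x) \<partial>\<mu> L)"
        using m by (simp add: nn_integral_add nn_integral_cmult)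
      also have "\<dots> = (\<integral>\<^sup>+ x. ennreal (f' x) \<partial>\<mu> L) + ennreal (2 * (1 / 2) ^ k * J)"
        unfolding J(2) using J(1) by (subst ennreal_mult) auto
      finally show ?thesis .
    qed
    show "1 \<le> (\<integral>\<^sup>+ x. ennreal (f' x) \<partial>\<mu> L)"
    proof (rule ennreal_le_epsilon)
      fix e :: real assume e: "0 < e"
      have "(\<lambda>k. 2 * (1 / 2) ^ k * J) \<longlonglongrightarrow> 2 * 0 * J"
        by (intro tendsto_intros LIMSEQ_power_zero) auto
      then have "eventually (\<lambda>k. 2 * (1 / 2) ^ k * J < e) sequentially"
        using e by (intro order_tendstoD) auto
      then obtain k where "2 * (1 / 2) ^ k * J < e" by (auto simp: eventually_sequentially)
      then have "ennreal (2 * (1 / 2) ^ k * J) \<le> ennreal e" by (intro ennreal_leI) auto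
      then show "1 \<le> (\<integral>\<^sup>+ x. ennreal (f' x) \<partial>\<mu> L) + ennreal e"
        using key[of k] by (meson add_left_mono order_trans)
    qed
  qed
  then have adm': "f' \<in> adm p M \<mu> F"
    using f'i f'0 by (auto simp: adm_def Lp_space_def)
  have "Lp_norm p M f' \<le> Lp_norm p M h" if "h \<in> adm p M \<mu> F" for h
    unfolding Lp_norm_energy using f'_energy I_le[OF that] p
    by (intro powr_mono2) (auto simp: energy_nonneg)
  then have "(INF h\<in>adm p M \<mu> F. ennreal (Lp_norm p M h)) = ennreal (Lp_norm p M f')"
    using adm' by (intro antisym INF_lower INF_greatest ennreal_leI) auto
  then show ?thesis using adm' nonempty by (auto simp: extremal_def modulus_def)
qed

end

section \<open>Fubini in foliated charts\<close>

lemma smooth_on_imp_continuous_on: "smooth_on S f \<Longrightarrow> continuous_on S f"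
  unfolding smooth_on_def by (metis differentiable_upto.simps(1))

lemma continuous_on_det:
  fixes A :: "'a::topological_space \<Rightarrow> real ^ 'n::finite ^ 'n"
  assumes "\<And>i j. continuous_on S (\<lambda>x. A x $ i $ j)"
  shows "continuous_on S (\<lambda>x. det (A x))"
  unfolding det_def
  by (intro continuous_on_sum continuous_on_mult continuous_on_const continuous_on_prod assms)

text \<open>\<open>\<nu>\<close> is the Borel measure underneath the completed volume; the chart
  formula is available for Borel sets only.\<close>

locale riemannian_foliation =
  fixes \<A> :: "('a::{t2_space, second_countable_topology}, 'n::finite) chart set"
    and g :: "('a, 'n) chart \<Rightarrow> real ^ 'n \<Rightarrow> real ^ 'n ^ 'n"
    and K :: "'n set"
    and \<Phi> :: "('a, 'n) chart set"
    and \<nu> :: "'a measure"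
  assumes smooth: "smooth_structure \<A>"
    and metric: "riemannian_metric \<A> g"
    and atlas: "foliated_atlas \<A> K \<Phi>"
    and sets_\<nu> [measurable_cong]: "sets \<nu> = sets borel"
    and emeasure_\<nu>: "c \<in> \<A> \<Longrightarrow> A \<in> sets borel \<Longrightarrow> A \<subseteq> fst c \<Longrightarrow> emeasure \<nu> A =
          (\<integral>\<^sup>+ y. ennreal (sqrt (det (g c y))) * indicator (snd c ` A) y \<partial>lborel)"
begin

abbreviation im :: "('a, 'n) chart \<Rightarrow> (real ^ 'n) set" where
  "im c \<equiv> snd c ` fst c"

abbreviation para :: "('a, 'n) chart \<Rightarrow> real ^ 'n \<Rightarrow> 'a" where
  "para c \<equiv> inv_into (fst c) (snd c)"

lemma chart_in_atlas: "c \<in> \<Phi> \<Longrightarrow> c \<in> \<A>"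
  using atlas by (auto simp: foliated_atlas_def)

lemma chart:
  assumes "c \<in> \<Phi>"
  shows "open (fst c)" "open (im c)" "homeomorphism (fst c) (im c) (snd c) (para c)"
proof -
  have "is_chart c" using smooth chart_in_atlas[OF assms] unfolding smooth_structure_def by blast
  then show "open (fst c)" "open (im c)" "homeomorphism (fst c) (im c) (snd c) (para c)"
    by (simp_all add: is_chart_def case_prod_beta)
qed

lemma chart_continuous:
  assumes "c \<in> \<Phi>"
  shows "continuous_on (fst c) (snd c)" "continuous_on (im c) (para c)"
  using chart(3)[OF assms] by (auto simp: homeomorphism_def)

lemma para_chart: "c \<in> \<Phi> \<Longrightarrow> x \<in> fst c \<Longrightarrow> para c (snd c x) = x"
  using chart(3) by (auto simp: homeomorphism_def)

lemma chart_para: "y \<in> im c \<Longrightarrow> snd c (para c y) = y"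
  by (rule f_inv_into_f)

lemma para_in: "y \<in> im c \<Longrightarrow> para c y \<in> fst c"
  by (rule inv_into_into)

lemma open_chart_image:
  assumes c: "c \<in> \<Phi>" and W: "open W" "W \<subseteq> fst c"
  shows "open (snd c ` W)"
proof -
  have "openin (top_of_set (im c)) (snd c ` W)"
    by (rule homeomorphism_imp_open_map[OF chart(3)[OF c] open_subset[OF W(2,1)]])
  then show ?thesis using chart(2)[OF c] openin_open_eq by blast
qed

text \<open>A coordinate map has arbitrary values off its domain, so it is extended by a constant to
  become Borel on the whole space.\<close>

lemma borel_chart [measurable]:
  assumes "c \<in> \<Phi>"
  shows "(\<lambda>x. if x \<in> fst c then snd c x else 0) \<in> borel_measurable borel"
  using chart[OF assms] chart_continuous[OF assms] by (intro borel_measurable_continuous_on_if) auto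

lemma borel_para [measurable]:
  assumes "c \<in> \<Phi>"
  shows "(\<lambda>y. if y \<in> im c then para c y else a) \<in> borel_measurable borel"
  using chart[OF assms] chart_continuous[OF assms] by (intro borel_measurable_continuous_on_if) auto

lemma chart_image_eq:
  assumes c: "c \<in> \<Phi>" and "B \<subseteq> fst c"
  shows "snd c ` B = {y \<in> im c. para c y \<in> B}"
  using assms para_chart[OF c] chart_para para_in by (auto intro: rev_image_eqI)

lemma borel_chart_image:
  assumes c: "c \<in> \<Phi>" and B: "B \<in> sets borel" "B \<subseteq> fst c"
  shows "snd c ` B \<in> sets borel"
proof -
  let ?f = "\<lambda>y. if y \<in> im c then para c y else undefined"
  have "im c \<inter> (?f -` B \<inter> space borel) \<in> sets borel"
    using measurable_sets[OF borel_para[OF c] B(1)] chart(2)[OF c] by auto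
  moreover have "snd c ` B = im c \<inter> (?f -` B \<inter> space borel)"
    unfolding chart_image_eq[OF c B(2)] by auto
  ultimately show ?thesis by simp
qed

lemma borel_chart_vimage:
  assumes c: "c \<in> \<Phi>" and S: "S \<in> sets borel"
  shows "{x \<in> fst c. snd c x \<in> S} \<in> sets borel"
proof -
  let ?f = "\<lambda>x. if x \<in> fst c then snd c x else 0"
  have "fst c \<inter> (?f -` S \<inter> space borel) \<in> sets borel"
    using measurable_sets[OF borel_chart[OF c] S] chart(1)[OF c] by auto
  moreover have "{x \<in> fst c. snd c x \<in> S} = fst c \<inter> (?f -` S \<inter> space borel)" by auto
  ultimately show ?thesis by simp
qed

section \<open>Volume densities and null sets in charts\<close>

lemma continuous_metric:
  assumes "c \<in> \<Phi>"
  shows "continuous_on (im c) (\<lambda>y. g c y $ i $ j)"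
  using metric chart_in_atlas[OF assms] by (auto simp: riemannian_metric_def intro: smooth_on_imp_continuous_on)

lemma det_metric_pos:
  assumes "c \<in> \<Phi>" "y \<in> im c"
  shows "0 < det (g c y)"
  using metric chart_in_atlas[OF assms(1)] assms(2) by (intro det_posdef_pos) (auto simp: riemannian_metric_def)

lemma borel_volume_density:
  assumes c: "c \<in> \<Phi>"
  shows "(\<lambda>y. if y \<in> im c then ennreal (sqrt (det (g c y))) else 0) \<in> borel_measurable borel"
proof -
  have "continuous_on (im c) (\<lambda>y. sqrt (det (g c y)))"
    by (intro continuous_on_real_sqrt continuous_on_det continuous_metric c)
  then have "(\<lambda>y. if y \<in> im c then sqrt (det (g c y)) else 0) \<in> borel_measurable borel"
    using chart(2)[OF c] by (intro borel_measurable_continuous_on_if) auto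
  then have "(\<lambda>y. ennreal (if y \<in> im c then sqrt (det (g c y)) else 0)) \<in> borel_measurable borel"
    by measurable
  then show ?thesis by (simp add: if_distrib[of ennreal] cong: if_cong)
qed

lemma borel_leaf_density:
  assumes c: "c \<in> \<Phi>"
  shows "(\<lambda>y. if y \<in> im c then ennreal (sqrt (principal_minor K (g c y))) else 0) \<in> borel_measurable borel"
proof -
  have entry: "continuous_on (im c) (\<lambda>y. if i \<in> K \<and> j \<in> K then g c y $ i $ j else if i = j then 1 else 0)" for i j
    using continuous_metric[OF c] by (cases "i \<in> K \<and> j \<in> K") auto
  have "continuous_on (im c) (\<lambda>y. sqrt (principal_minor K (g c y)))"
    unfolding principal_minor_def using entry
    by (intro continuous_on_real_sqrt continuous_on_det) (simp only: vec_lambda_beta)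
  then have "(\<lambda>y. if y \<in> im c then sqrt (principal_minor K (g c y)) else 0) \<in> borel_measurable borel"
    using chart(2)[OF c] by (intro borel_measurable_continuous_on_if) auto
  then have "(\<lambda>y. ennreal (if y \<in> im c then sqrt (principal_minor K (g c y)) else 0)) \<in> borel_measurable borel"
    by measurable
  then show ?thesis by (simp add: if_distrib[of ennreal] cong: if_cong)
qed

text \<open>The volume density is positive on the chart image, so a vanishing integral forces the
  image to be Lebesgue null.\<close>

lemma null_borel_image:
  assumes c: "c \<in> \<Phi>" and B: "B \<in> null_sets \<nu>"
  shows "snd c ` (B \<inter> fst c) \<in> null_sets lborel"
proof -
  have "B \<in> sets borel" using null_setsD2[OF B] by (simp only: sets_\<nu>)
  then have BU: "B \<inter> fst c \<in> sets borel" by (rule sets.Int[OF _ borel_open[OF chart(1)[OF c]]])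
  note S = borel_chart_image[OF c BU]
  let ?f = "\<lambda>y. (if y \<in> im c then ennreal (sqrt (det (g c y))) else 0) * indicator (snd c ` (B \<inter> fst c)) y"
  have "(\<integral>\<^sup>+ y. ?f y \<partial>lborel) = (\<integral>\<^sup>+ y. ennreal (sqrt (det (g c y))) * indicator (snd c ` (B \<inter> fst c)) y \<partial>lborel)"
    by (intro nn_integral_cong) (auto simp: indicator_def)
  also have "\<dots> = emeasure \<nu> (B \<inter> fst c)"
    using BU by (subst emeasure_\<nu>[OF chart_in_atlas[OF c]]) auto
  also have "\<dots> = 0"
    by (rule emeasure_eq_0[OF null_setsD2[OF B] null_setsD1[OF B]]) simp
  finally have "AE y in lborel. ?f y = 0"
    using S borel_volume_density[OF c] by (subst (asm) nn_integral_0_iff_AE) auto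
  then have "AE y in lborel. y \<notin> snd c ` (B \<inter> fst c)"
  proof eventually_elim
    case (elim y)
    show ?case
    proof
      assume y: "y \<in> snd c ` (B \<inter> fst c)"
      then have "y \<in> im c" by auto
      then show False using elim y det_metric_pos[OF c, of y] by simp
    qed
  qed
  then show ?thesis using S by (simp add: AE_iff_null_sets)
qed

text \<open>A superset is asserted because \<open>lborel\<close> is not complete: the image of a
  null set of the completion need not be Borel.\<close>

lemma null_image_ex:
  assumes c: "c \<in> \<Phi>" and B: "B \<in> null_sets (completion \<nu>)"
  obtains S where "S \<in> null_sets lborel" "snd c ` (B \<inter> fst c) \<subseteq> S"
proof -
  obtain B' where "B' \<in> null_sets \<nu>" "B \<subseteq> B'" using B by (auto simp: null_sets_completion_iff2)
  then show ?thesis using null_borel_image[OF c, of B'] by (intro that) auto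
qed

lemma null_vimage:
  assumes c: "c \<in> \<Phi>" and S: "S \<in> null_sets lborel"
  shows "{x \<in> fst c. snd c x \<in> S} \<in> null_sets \<nu>"
proof -
  have B: "{x \<in> fst c. snd c x \<in> S} \<in> sets borel"
    using borel_chart_vimage[OF c, of S] S by (simp add: null_sets_def)
  have "emeasure \<nu> {x \<in> fst c. snd c x \<in> S} =
    (\<integral>\<^sup>+ y. ennreal (sqrt (det (g c y))) * indicator (snd c ` {x \<in> fst c. snd c x \<in> S}) y \<partial>lborel)"
    using B by (intro emeasure_\<nu> chart_in_atlas c) auto
  also have "\<dots> = (\<integral>\<^sup>+ y. 0 \<partial>(lborel :: (real ^ 'n) measure))"
  proof (rule nn_integral_cong_AE)
    show "AE y in lborel. ennreal (sqrt (det (g c y))) * indicator (snd c ` {x \<in> fst c. snd c x \<in> S}) y = 0"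
      using AE_not_in[OF S] by eventually_elim (auto simp: indicator_def)
  qed
  finally show ?thesis using B sets_\<nu> by (simp add: null_sets_def)
qed

section \<open>Plaques and leaves\<close>

lemma plaque_in: "x \<in> fst c \<Longrightarrow> x \<in> plaque K c x"
  by (simp add: plaque_def)

lemma plaque_eq: "z \<in> plaque K c x \<Longrightarrow> plaque K c z = plaque K c x"
  by (auto simp: plaque_def)

lemma plaque_sub: "plaque K c x \<subseteq> fst c"
  by (auto simp: plaque_def)

lemma plaques_memD:
  assumes "P \<in> plaques K \<Psi>" "x \<in> P"
  obtains c where "c \<in> \<Psi>" "x \<in> fst c" "P = plaque K c x"
proof -
  obtain c x0 where c: "c \<in> \<Psi>" "P = plaque K c x0" using assms(1) by (auto simp: plaques_def)
  show ?thesis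
  proof (rule that[OF c(1)])
    show "x \<in> fst c" using assms(2) c(2) by (simp add: plaque_def)
    show "P = plaque K c x" using plaque_eq[of x c x0] assms(2) c(2) by simp
  qed
qed

lemma plaque_in_plaques: "c \<in> \<Psi> \<Longrightarrow> x \<in> fst c \<Longrightarrow> plaque K c x \<in> plaques K \<Psi>"
  unfolding plaques_def by blast

lemma plaques_mono: "\<Psi> \<subseteq> \<Psi>' \<Longrightarrow> plaques K \<Psi> \<subseteq> plaques K \<Psi>'"
  unfolding plaques_def by blast

lemma coherent: "P \<in> plaques K \<Phi> \<Longrightarrow> Q \<in> plaques K \<Phi> \<Longrightarrow> openin (top_of_set P) (P \<inter> Q)"
  using atlas by (auto simp: foliated_atlas_def)

lemma borel_plaque:
  assumes c: "c \<in> \<Phi>"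
  shows "plaque K c x \<in> sets borel"
proof -
  have "{y :: real ^ 'n. \<forall>i. i \<notin> K \<longrightarrow> y $ i = snd c x $ i} = (\<Inter>i\<in>- K. {y. y $ i = snd c x $ i})"
    by auto
  moreover have "closed \<dots>"
    by (intro closed_INT ballI closed_Collect_eq continuous_intros)
  ultimately have "{y :: real ^ 'n. \<forall>i. i \<notin> K \<longrightarrow> y $ i = snd c x $ i} \<in> sets borel"
    by (simp only: borel_closed)
  from borel_chart_vimage[OF c this] show ?thesis by (simp add: plaque_def)
qed

text \<open>In coordinates a plaque is a slice of a product of intervals, hence convex, and
  \<open>para c\<close> carries it back continuously. Connectedness is what lets a countable
  subatlas generate the same leaves.\<close>

lemma connected_plaque:
  assumes c: "c \<in> \<Phi>" and x: "x \<in> fst c"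
  shows "connected (plaque K c x)"
proof -
  obtain I where I: "\<And>i. is_interval (I i :: real set)" "im c = {y. \<forall>i. y $ i \<in> I i}"
  proof -
    have "\<forall>c\<in>\<Phi>. \<exists>I. (\<forall>i. open (I i) \<and> is_interval (I i :: real set)) \<and> im c = {y. \<forall>i. y $ i \<in> I i}"
      using atlas unfolding foliated_atlas_def by (elim conjE)
    then show ?thesis using c that by blast
  qed
  let ?S = "{y \<in> im c. \<forall>i. i \<notin> K \<longrightarrow> y $ i = snd c x $ i}"
  have "convex ?S"
  proof (rule convexI)
    fix y z :: "real ^ 'n" and u v :: real
    assume y: "y \<in> ?S" and z: "z \<in> ?S" and uv: "0 \<le> u" "0 \<le> v" "u + v = 1"
    have "(u *\<^sub>R y + v *\<^sub>R z) $ i \<in> I i" for i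
    proof -
      have "convex (I i)" using I(1) by (simp add: is_interval_convex)
      moreover have "y $ i \<in> I i" "z $ i \<in> I i" using y z unfolding I(2) by blast+
      ultimately have "u *\<^sub>R (y $ i) + v *\<^sub>R (z $ i) \<in> I i"
        using uv by (rule convexD)
      then show ?thesis by simp
    qed
    moreover have "(u *\<^sub>R y + v *\<^sub>R z) $ i = snd c x $ i" if "i \<notin> K" for i
      using y z uv that by (simp add: distrib_right[symmetric])
    ultimately show "u *\<^sub>R y + v *\<^sub>R z \<in> ?S" unfolding I(2) by auto
  qed
  then have "connected (para c ` ?S)"
    using chart_continuous(2)[OF c] by (intro connected_continuous_image convex_connected) (auto intro: continuous_on_subset)
  also have "para c ` ?S = plaque K c x"
  proof (intro equalityI subsetI)
    fix z assume "z \<in> para c ` ?S"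
    then obtain y where y: "y \<in> ?S" "z = para c y" by blast
    then show "z \<in> plaque K c x" using chart_para[of y c] para_in[of y c] by (simp add: plaque_def)
  next
    fix z assume z: "z \<in> plaque K c x"
    then have "snd c z \<in> ?S" "z = para c (snd c z)" using para_chart[OF c] by (auto simp: plaque_def)
    then show "z \<in> para c ` ?S" by blast
  qed
  finally show ?thesis .
qed

text \<open>The atlas is a parameter so that chains through a countable subatlas can be compared
  with chains through \<open>\<Phi>\<close>.\<close>

definition same_plaque :: "('a, 'n) chart set \<Rightarrow> ('a \<times> 'a) set" where
  "same_plaque \<Psi> = {(x, y). \<exists>P\<in>plaques K \<Psi>. x \<in> P \<and> y \<in> P}"

lemma sym_same_plaque: "sym (same_plaque \<Psi>)"
  by (auto simp: sym_def same_plaque_def)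

lemma equiv_leaf: "equiv UNIV ((same_plaque \<Psi>)\<^sup>*)"
  using sym_same_plaque by (auto intro!: equivI refl_rtrancl sym_rtrancl trans_rtrancl)

lemma leaves_eq: "leaves K \<Psi> = UNIV // (same_plaque \<Psi>)\<^sup>*"
  by (simp add: leaves_def same_plaque_def)

lemma ex_countable_subatlas:
  obtains C where "countable C" "C \<subseteq> \<Phi>" "(\<Union>c\<in>C. fst c) = UNIV"
proof -
  have cov: "\<Union>(fst ` \<Phi>) = UNIV" using atlas by (auto simp: foliated_atlas_def)
  have op: "open S" if "S \<in> fst ` \<Phi>" for S using chart(1) that by (elim imageE) simp
  obtain \<U> where U: "\<U> \<subseteq> fst ` \<Phi>" "countable \<U>" "\<Union>\<U> = UNIV"
    using Lindelof[of "fst ` \<Phi>", OF op] unfolding cov by metis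
  obtain C where C: "C \<subseteq> \<Phi>" "countable C" "\<U> = fst ` C"
    using U(1,2) countable_subset_image[of \<U> fst \<Phi>] by metis
  show ?thesis using that[OF C(2,1)] U(3) C(3) by simp
qed

text \<open>A plaque is connected and meets the plaques of the subatlas in relatively open sets, so it lies
  in a single class.\<close>

lemma same_plaque_subatlas:
  assumes C: "C \<subseteq> \<Phi>" "(\<Union>c\<in>C. fst c) = UNIV"
  shows "(same_plaque C)\<^sup>* = (same_plaque \<Phi>)\<^sup>*"
proof (rule antisym)
  show "(same_plaque C)\<^sup>* \<subseteq> (same_plaque \<Phi>)\<^sup>*"
    using plaques_mono[OF C(1)] by (intro rtrancl_mono) (auto simp: same_plaque_def)
  have "(x, y) \<in> (same_plaque C)\<^sup>*" if xy: "(x, y) \<in> same_plaque \<Phi>" for x y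
  proof -
    obtain P where P: "P \<in> plaques K \<Phi>" "x \<in> P" "y \<in> P" using xy by (auto simp: same_plaque_def)
    have conn: "connected P"
      using plaques_memD[OF P(1,2)] connected_plaque by metis
    let ?R = "(same_plaque C)\<^sup>*"
    show ?thesis
    proof (rule connected_equivalence_relation[OF conn P(2,3), of "\<lambda>x y. (x, y) \<in> ?R"])
      fix a b assume "(a, b) \<in> ?R" then show "(b, a) \<in> ?R"
        using equiv_leaf[of C] by (auto simp: equiv_def sym_def)
    next
      fix a b c assume "(a, b) \<in> ?R" "(b, c) \<in> ?R" then show "(a, c) \<in> ?R" by (rule rtrancl_trans)
    next
      fix a assume a: "a \<in> P"
      obtain c where c: "c \<in> C" "a \<in> fst c" using C(2) by blast
      let ?Q = "plaque K c a"
      have "openin (top_of_set P) (P \<inter> ?Q)"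
        using c C by (intro coherent P) (auto intro: plaque_in_plaques)
      moreover have "a \<in> P \<inter> ?Q" using a c plaque_in[of a c] by auto
      moreover have "(a, z) \<in> ?R" if "z \<in> P \<inter> ?Q" for z
      proof -
        have "(a, z) \<in> same_plaque C"
          unfolding same_plaque_def using that plaque_in[OF c(2)] plaque_in_plaques[OF c]
          by (auto intro!: bexI[of _ ?Q])
        then show ?thesis by blast
      qed
      ultimately show "\<exists>T. openin (top_of_set P) T \<and> a \<in> T \<and> (\<forall>x\<in>T. (a, x) \<in> ?R)" by blast
    qed
  qed
  then show "(same_plaque \<Phi>)\<^sup>* \<subseteq> (same_plaque C)\<^sup>*"
    by (metis rtrancl_subset_rtrancl subrelI)
qed

text \<open>Openness in the leaf topology, tested on plaques so that this topology need not be
  constructed.\<close>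

definition leafwise_open :: "'a set \<Rightarrow> bool" where
  "leafwise_open B \<longleftrightarrow> (\<forall>P\<in>plaques K \<Phi>. openin (top_of_set P) (P \<inter> B))"

lemma leafwise_open_UN:
  assumes "\<And>i. i \<in> I \<Longrightarrow> leafwise_open (B i)"
  shows "leafwise_open (\<Union>i\<in>I. B i)"
  unfolding leafwise_open_def Int_UN_distrib
  using assms by (intro ballI openin_Union) (auto simp: leafwise_open_def)

lemma leafwise_open_plaques:
  assumes c: "c \<in> \<Phi>" and B: "B \<subseteq> fst c" "\<And>x. x \<in> B \<Longrightarrow> plaque K c x \<subseteq> B"
  shows "leafwise_open B"
proof -
  have "x \<in> plaque K c x" if "x \<in> B" for x using that B(1) plaque_in[of x c] by auto
  then have "B = (\<Union>x\<in>B. plaque K c x)" using B(2) by auto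
  moreover have "leafwise_open (\<Union>x\<in>B. plaque K c x)"
  proof (rule leafwise_open_UN)
    fix x assume "x \<in> B"
    then show "leafwise_open (plaque K c x)"
      using B(1) c by (auto simp: leafwise_open_def intro!: coherent plaque_in_plaques)
  qed
  ultimately show ?thesis by simp
qed

definition saturate :: "('a, 'n) chart \<Rightarrow> 'a set \<Rightarrow> 'a set" where
  "saturate c B = {x \<in> fst c. plaque K c x \<inter> B \<noteq> {}}"

lemma leafwise_open_saturate: "c \<in> \<Phi> \<Longrightarrow> leafwise_open (saturate c B)"
proof (rule leafwise_open_plaques)
  fix x assume "x \<in> saturate c B"
  then show "plaque K c x \<subseteq> saturate c B"
    using plaque_eq[of _ c x] plaque_sub[of c x] by (auto simp: saturate_def)
qed (auto simp: saturate_def)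

text \<open>A plaque that meets a leafwise open set meets it in a set of positive leaf measure,
  so by Fubini almost no plaque of a chart meets a leafwise open null set.\<close>

lemma null_saturate:
  assumes c: "c \<in> \<Phi>" and B: "leafwise_open B" "B \<in> null_sets (completion \<nu>)"
  shows "saturate c B \<in> null_sets (completion \<nu>)"
proof -
  obtain S where S: "S \<in> null_sets lborel" "snd c ` (B \<inter> fst c) \<subseteq> S"
    using null_image_ex[OF c B(2)] .
  have "saturate c B \<subseteq> {x \<in> fst c. snd c x \<in> {y. \<not> null_slice K S y}}"
  proof
    fix x assume "x \<in> saturate c B"
    then obtain z where x: "x \<in> fst c" and z: "z \<in> plaque K c x" "z \<in> B" by (auto simp: saturate_def)
    let ?P = "plaque K c x"
    have "openin (top_of_set ?P) (?P \<inter> B)"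
      using B(1) plaque_in_plaques[OF c x] by (auto simp: leafwise_open_def)
    then obtain T where T: "open T" "?P \<inter> B = ?P \<inter> T" by (auto simp: openin_open)
    have "\<not> null_slice K S (snd c x)"
    proof (rule not_null_slice_open[of "snd c ` (T \<inter> fst c)" "snd c z"])
      show "open (snd c ` (T \<inter> fst c))"
        using T(1) chart(1)[OF c] by (intro open_chart_image c) auto
      have "z \<in> T" "z \<in> fst c" using z T(2) by (auto simp: plaque_def)
      then show "snd c z \<in> snd c ` (T \<inter> fst c)" by simp
      show "snd c z $ i = snd c x $ i" if "i \<notin> K" for i using z that by (simp add: plaque_def)
      show "S \<in> sets borel" using null_setsD2[OF S(1)] by simp
      fix y assume y: "y \<in> snd c ` (T \<inter> fst c)" "\<And>i. i \<notin> K \<Longrightarrow> y $ i = snd c x $ i"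
      then obtain w where w: "w \<in> T" "w \<in> fst c" "y = snd c w" by blast
      then have "w \<in> ?P" using y(2) by (simp add: plaque_def)
      then have "w \<in> B" using w(1) T(2) by blast
      then show "y \<in> S" using S(2) w by blast
    qed
    then show "x \<in> {x \<in> fst c. snd c x \<in> {y. \<not> null_slice K S y}}" using x by simp
  qed
  then show ?thesis
    using null_sets_completionI[OF null_vimage[OF c null_sets_non_null_slices[OF S(1)]]]
    by (rule null_sets_completion_subset)
qed

lemma leaf_disjoint:
  assumes "L \<in> leaves K \<Phi>" "L' \<in> leaves K \<Phi>" "x \<in> L" "x \<in> L'"
  shows "L = L'"
  using quotient_disj[OF equiv_leaf] assms unfolding leaves_eq by blast

lemma leaf_Image:
  assumes "L \<in> leaves K \<Phi>" "x \<in> L"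
  shows "L = (same_plaque \<Phi>)\<^sup>* `` {x}"
  using assms leaf_disjoint[OF assms(1) _ assms(2)] unfolding leaves_eq
  by (metis UNIV_I equiv_class_self equiv_leaf quotientI)

lemma plaque_subset_leaf:
  assumes "L \<in> leaves K \<Phi>" "x \<in> L" "c \<in> \<Phi>" "x \<in> fst c"
  shows "plaque K c x \<subseteq> L"
proof
  fix z assume z: "z \<in> plaque K c x"
  have "(x, z) \<in> same_plaque \<Phi>"
    unfolding same_plaque_def using z plaque_in[OF assms(4)] plaque_in_plaques[OF assms(3,4)] by blast
  then show "z \<in> L" unfolding leaf_Image[OF assms(1,2)] by blast
qed

end

section \<open>Chains of plaques through a countable subatlas\<close>

locale riemannian_foliation_subatlas = riemannian_foliation \<A> g K \<Phi> \<nu>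
  for \<A> :: "('a::{t2_space, second_countable_topology}, 'n::finite) chart set"
    and g K \<Phi> \<nu> +
  fixes C :: "('a, 'n) chart set"
  assumes countable_C: "countable C" and C_sub: "C \<subseteq> \<Phi>" and C_cover: "(\<Union>c\<in>C. fst c) = UNIV"
begin

lemma leaf_Image_subatlas:
  assumes "L \<in> leaves K \<Phi>" "x \<in> L"
  shows "L = (same_plaque C)\<^sup>* `` {x}"
  using leaf_Image[OF assms] same_plaque_subatlas[OF C_sub C_cover] by simp

text \<open>Iterated saturation over the countably many charts of \<open>C\<close> reaches every
  leaf through \<open>B\<close>. Leafwise openness is carried along with nullity because it is what
  keeps the next saturation null.\<close>

lemma null_leaves_meeting:
  assumes B: "leafwise_open B" "B \<in> null_sets (completion \<nu>)"
  shows "\<Union>{L \<in> leaves K \<Phi>. L \<inter> B \<noteq> {}} \<in> null_sets (completion \<nu>)"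
proof -
  \<comment> \<open>The points joined to \<open>B\<close> by a chain of \<open>n\<close> plaques of
    \<open>C\<close>.\<close>
  define S where "S n = ((\<lambda>B. \<Union>c\<in>C. saturate c B) ^^ n) B" for n
  have S0: "S 0 = B" and S_Suc: "S (Suc n) = (\<Union>c\<in>C. saturate c (S n))" for n by (auto simp: S_def)
  have S: "leafwise_open (S n) \<and> S n \<in> null_sets (completion \<nu>)" for n
  proof (induction n)
    case (Suc n)
    then show ?case
      unfolding S_Suc using C_sub countable_C
      by (intro conjI leafwise_open_UN null_sets_UN') (auto intro: leafwise_open_saturate null_saturate)
  qed (use B S0 in simp)
  have "\<Union>{L \<in> leaves K \<Phi>. L \<inter> B \<noteq> {}} \<subseteq> (\<Union>n. S n)"
  proof
    fix z assume "z \<in> \<Union>{L \<in> leaves K \<Phi>. L \<inter> B \<noteq> {}}"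
    then obtain L y where L: "L \<in> leaves K \<Phi>" "z \<in> L" "y \<in> L" "y \<in> B" by blast
    then have "(y, z) \<in> (same_plaque C)\<^sup>*" using leaf_Image_subatlas[OF L(1,3)] by blast
    then show "z \<in> (\<Union>n. S n)"
    proof induction
      case base
      then show ?case using L(4) S0 by blast
    next
      case (step x z)
      obtain n where n: "x \<in> S n" using step by blast
      obtain P where P: "P \<in> plaques K C" "x \<in> P" "z \<in> P" using step by (auto simp: same_plaque_def)
      obtain c where c: "c \<in> C" "z \<in> fst c" "P = plaque K c z" using plaques_memD[OF P(1,3)] .
      have "z \<in> saturate c (S n)" using c P n by (auto simp: saturate_def)
      then have "z \<in> S (Suc n)" unfolding S_Suc using c by blast
      then show ?case by blast
    qed
  qed
  moreover have "(\<Union>n. S n) \<in> null_sets (completion \<nu>)"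
    using S by (intro null_sets_UN) simp
  ultimately show ?thesis by (rule null_sets_completion_subset)
qed

text \<open>Compositions of these Borel maps, with \<open>snd cq\<close> in a countable dense set, reach every plaque of
  a leaf, because the plaques of a chain meet in relatively open sets.\<close>

definition hop :: "('a, 'n) chart \<times> (real ^ 'n) \<Rightarrow> 'a \<Rightarrow> 'a" where
  "hop cq x = (let c = fst cq; y = slice_point K (snd c x) (($) (snd cq)) in
     if x \<in> fst c \<and> y \<in> im c then para c y else x)"

definition hops :: "(('a, 'n) chart \<times> (real ^ 'n)) list \<Rightarrow> 'a \<Rightarrow> 'a" where
  "hops w x = fold hop w x"

lemma borel_hop:
  assumes c: "c \<in> \<Phi>"
  shows "hop (c, q) \<in> borel_measurable borel"
proof -
  let ?f = "\<lambda>x. if x \<in> fst c then snd c x else 0"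
  let ?s = "\<lambda>x. slice_point K (?f x) (($) q)"
  have s [measurable]: "?s \<in> borel_measurable borel"
  proof (rule borel_measurable_vecI)
    fix i show "(\<lambda>x. ?s x $ i) \<in> borel_measurable borel"
      using measurable_compose[OF borel_chart[OF c] borel_measurable_nth] unfolding slice_point_nth by (cases "i \<in> K") auto
  qed
  have m [measurable]: "fst c \<in> sets borel" "im c \<in> sets borel" using chart[OF c] by auto
  let ?T = "{x \<in> space borel. x \<in> fst c \<and> ?s x \<in> im c}"
  have T: "?T \<in> sets borel" by measurable
  have p: "(\<lambda>x. (\<lambda>y. if y \<in> im c then para c y else undefined) (?s x)) \<in> borel_measurable borel"
    by (rule measurable_compose[OF s borel_para[OF c]])
  have "(\<lambda>x. if x \<in> ?T then (\<lambda>y. if y \<in> im c then para c y else undefined) (?s x) else x) \<in> borel_measurable borel"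
    using T p by (intro measurable_If_set) (auto intro: measurable_ident_sets)
  also have "(\<lambda>x. if x \<in> ?T then (\<lambda>y. if y \<in> im c then para c y else undefined) (?s x) else x) = hop (c, q)"
    by (auto simp: hop_def Let_def fun_eq_iff)
  finally show ?thesis .
qed

lemma borel_hops: "w \<in> lists (C \<times> UNIV) \<Longrightarrow> hops w \<in> borel_measurable borel"
proof (induction w)
  case Nil
  then show ?case by (simp add: hops_def)
next
  case (Cons cq w)
  obtain c q where cq: "cq = (c, q)" "c \<in> \<Phi>" using Cons(2) C_sub by auto
  have "hops (cq # w) = (\<lambda>x. hops w (hop cq x))" by (simp add: hops_def fun_eq_iff)
  then show ?case using measurable_compose[OF borel_hop[OF cq(2)]] Cons cq by auto
qed

lemma hop_same_plaque:
  assumes "c \<in> \<Phi>"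
  shows "(x, hop (c, q) x) \<in> (same_plaque \<Phi>)\<^sup>*"
proof (cases "x \<in> fst c \<and> slice_point K (snd c x) (($) q) \<in> im c")
  case True
  then have "hop (c, q) x = para c (slice_point K (snd c x) (($) q))" by (simp add: hop_def Let_def)
  then have "hop (c, q) x \<in> plaque K c x"
    using True chart_para[of "slice_point K (snd c x) (($) q)" c] para_in by (simp add: plaque_def slice_point_nth)
  then have "(x, hop (c, q) x) \<in> same_plaque \<Phi>"
    unfolding same_plaque_def using True plaque_in[of x c] plaque_in_plaques[OF assms, of x] by auto
  then show ?thesis by blast
qed (auto simp: hop_def Let_def)

lemma hops_leaf:
  assumes "L \<in> leaves K \<Phi>" "x \<in> L" "w \<in> lists (C \<times> UNIV)"
  shows "hops w x \<in> L"
proof -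
  have "(x, hops w x) \<in> (same_plaque \<Phi>)\<^sup>*"
    using assms(3)
  proof (induction w arbitrary: x)
    case (Cons cq w)
    obtain c q where cq: "cq = (c, q)" "c \<in> \<Phi>" using Cons(1) C_sub by auto
    have "(x, hop cq x) \<in> (same_plaque \<Phi>)\<^sup>*" unfolding cq(1) by (rule hop_same_plaque[OF cq(2)])
    also have "(hop cq x, hops w (hop cq x)) \<in> (same_plaque \<Phi>)\<^sup>*" using Cons by auto
    finally show ?case by (simp add: hops_def)
  qed (simp add: hops_def)
  then show ?thesis using leaf_Image[OF assms(1,2)] by blast
qed

text \<open>The target is a plaque and not a point, since countably many hops do not in general
  exhaust a leaf. The induction keeps \<open>P\<close> arbitrary: once the previous plaque
  \<open>P0\<close> is entered, one more hop inside \<open>P0\<close> lands in the relatively open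
  set \<open>P0 \<inter> P\<close>.\<close>

lemma hops_reach:
  assumes Q: "\<And>X :: (real ^ 'n) set. open X \<Longrightarrow> X \<noteq> {} \<Longrightarrow> \<exists>d\<in>Q. d \<in> X"
    and xy: "(x, y) \<in> (same_plaque C)\<^sup>*" and P: "P \<in> plaques K C" "y \<in> P"
  shows "\<exists>w\<in>lists (C \<times> Q). hops w x \<in> P"
  using xy P
proof (induction arbitrary: P)
  case base
  then show ?case by (intro bexI[of _ "[]"]) (auto simp: hops_def)
next
  case (step y z P)
  obtain P0 where P0: "P0 \<in> plaques K C" "y \<in> P0" "z \<in> P0" using step(2) by (auto simp: same_plaque_def)
  obtain w where w: "w \<in> lists (C \<times> Q)" "hops w x \<in> P0" using step.IH[OF P0(1,2)] by blast
  let ?s = "hops w x"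
  obtain c where c: "c \<in> C" "?s \<in> fst c" "P0 = plaque K c ?s" using plaques_memD[OF P0(1) w(2)] .
  have c\<Phi>: "c \<in> \<Phi>" using c C_sub by auto
  have "openin (top_of_set P0) (P0 \<inter> P)"
    using P0(1) step(4) plaques_mono[OF C_sub] by (intro coherent) auto
  then obtain T where T: "open T" "P0 \<inter> P = P0 \<inter> T" by (auto simp: openin_open)
  let ?W = "snd c ` (T \<inter> fst c)"
  \<comment> \<open>The \<open>q\<close> whose leaf coordinates move \<open>?s\<close> into
    \<open>T\<close>, and so into \<open>P\<close>: an open set, nonempty because it contains
    \<open>snd c z\<close>.\<close>
  let ?X = "{u :: real ^ 'n. slice_point K (snd c ?s) (($) u) \<in> ?W}"
  have oW: "open ?W" using T(1) chart(1)[OF c\<Phi>] by (intro open_chart_image c\<Phi>) auto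
  have cont: "continuous_on UNIV (\<lambda>u :: real ^ 'n. slice_point K (snd c ?s) (($) u))"
    unfolding slice_point_def
  proof (rule continuous_on_vec_lambda)
    fix i show "continuous_on UNIV (\<lambda>u :: real ^ 'n. if i \<in> K then u $ i else snd c ?s $ i)"
      by (cases "i \<in> K") (auto intro: continuous_intros)
  qed
  have "open ?X" using open_vimage[OF oW cont] by (simp add: vimage_def)
  moreover have "snd c z \<in> ?X"
  proof -
    have "slice_point K (snd c ?s) (($) (snd c z)) = snd c z"
      using P0(3) c(3) by (auto simp: vec_eq_iff slice_point_nth plaque_def)
    moreover have "z \<in> T" using P0(3) step(5) T(2) by auto
    moreover have "z \<in> fst c" using P0(3) unfolding c(3) by (simp add: plaque_def)
    ultimately show ?thesis by auto
  qed
  ultimately obtain q where q: "q \<in> Q" "slice_point K (snd c ?s) (($) q) \<in> ?W" using Q[of ?X] by blast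
  then obtain v where v: "v \<in> T" "v \<in> fst c" "slice_point K (snd c ?s) (($) q) = snd c v" by blast
  have "hop (c, q) ?s = v" using v c(2) para_chart[OF c\<Phi>] by (simp add: hop_def Let_def)
  moreover have "v \<in> P0"
    unfolding c(3) plaque_def using v by (auto simp: v(3)[symmetric] slice_point_nth)
  ultimately have "hop (c, q) ?s \<in> P" using v(1) T(2) by blast
  moreover have "hops (w @ [(c, q)]) x = hop (c, q) ?s" by (simp add: hops_def)
  moreover have "w @ [(c, q)] \<in> lists (C \<times> Q)" using w q c by auto
  ultimately show ?case by metis
qed

end

section \<open>Integration along plaques\<close>

context riemannian_foliation begin

text \<open>The integrand for the induced volume in leaf coordinates, set to 0 outside the chart
  image so that it is Borel on the whole space.\<close>

definition plaque_density :: "('a, 'n) chart \<Rightarrow> ('a \<Rightarrow> ennreal) \<Rightarrow> real ^ 'n \<Rightarrow> ennreal" where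
  "plaque_density c h y =
     (if y \<in> im c then ennreal (sqrt (principal_minor K (g c y))) * h (para c y) else 0)"

definition plaque_integral :: "('a, 'n) chart \<Rightarrow> ('a \<Rightarrow> ennreal) \<Rightarrow> real ^ 'n \<Rightarrow> ennreal" where
  "plaque_integral c h y = (\<integral>\<^sup>+ u. plaque_density c h (slice_point K y u) \<partial>PiM K (\<lambda>_. lborel))"

lemma borel_plaque_density:
  assumes c: "c \<in> \<Phi>" and h: "h \<in> borel_measurable borel"
  shows "plaque_density c h \<in> borel_measurable borel"
proof -
  have "(\<lambda>y. (if y \<in> im c then ennreal (sqrt (principal_minor K (g c y))) else 0) *
      h (if y \<in> im c then para c y else undefined)) \<in> borel_measurable borel"
    by (intro borel_measurable_times_ennreal borel_leaf_density[OF c] measurable_compose[OF borel_para[OF c] h])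
  also have "(\<lambda>y. (if y \<in> im c then ennreal (sqrt (principal_minor K (g c y))) else 0) *
      h (if y \<in> im c then para c y else undefined)) = plaque_density c h"
    by (auto simp: plaque_density_def fun_eq_iff)
  finally show ?thesis .
qed

lemma borel_plaque_integral:
  assumes "c \<in> \<Phi>" "h \<in> borel_measurable borel"
  shows "plaque_integral c h \<in> borel_measurable borel"
  using measurable_slice_integral[OF borel_plaque_density[OF assms]]
  by (simp add: plaque_integral_def[abs_def])

lemma borel_plaque_density_slice:
  assumes "c \<in> \<Phi>" "h \<in> borel_measurable borel"
  shows "(\<lambda>u. plaque_density c h (slice_point K y u)) \<in> borel_measurable (PiM K (\<lambda>_. lborel))"
  by (rule measurable_compose[OF measurable_slice_point borel_plaque_density[OF assms]])

text \<open>\<open>leaf_measure\<close> prescribes only the measures of Borel sets inside a plaque;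
  the usual induction over nonnegative Borel functions carries the formula to integrals.\<close>

lemma nn_integral_plaque:
  assumes \<mu>: "leaf_measure g K \<Phi> L \<mu>" and L: "L \<in> leaves K \<Phi>"
    and c: "c \<in> \<Phi>" and x: "x \<in> fst c" "x \<in> L" and h: "h \<in> borel_measurable borel"
  shows "(\<integral>\<^sup>+ z. h z * indicator (plaque K c x) z \<partial>\<mu>) = plaque_integral c h (snd c x)"
proof -
  obtain \<nu>' where \<nu>': "\<mu> = completion \<nu>'" "sets \<nu>' = sets (restrict_space borel L)"
    and em: "\<And>c x A. c \<in> \<Phi> \<Longrightarrow> x \<in> fst c \<inter> L \<Longrightarrow> A \<in> sets borel \<Longrightarrow> A \<subseteq> plaque K c x \<Longrightarrow>
        emeasure \<nu>' A = (\<integral>\<^sup>+ u. ennreal (sqrt (principal_minor K (g c (slice_point K (snd c x) u))))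
          * indicator (snd c ` A) (slice_point K (snd c x) u) \<partial>(PiM K (\<lambda>_. lborel)))"
    using \<mu> unfolding leaf_measure_def by blast
  let ?P = "plaque K c x"
  have PL: "?P \<subseteq> L" by (rule plaque_subset_leaf[OF L x(2) c x(1)])
  have m: "f \<in> borel_measurable \<nu>'" if "f \<in> borel_measurable borel" for f :: "'a \<Rightarrow> ennreal"
    unfolding measurable_cong_sets[OF \<nu>'(2) refl] by (rule measurable_restrict_space1[OF that])
  note mP = borel_measurable_indicator[OF borel_plaque[OF c, of x]]
  have "(\<integral>\<^sup>+ z. h z * indicator ?P z \<partial>\<nu>') = plaque_integral c h (snd c x)"
    using h
  proof (induction rule: borel_measurable_induct)
    case (cong f g)
    then have "f = g" by auto
    with cong show ?case by simp
  next
    case (set A)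
    have AP: "A \<inter> ?P \<in> sets borel" using set borel_plaque[OF c] by auto
    have "L \<inter> (A \<inter> ?P) \<in> sets \<nu>'" unfolding \<nu>'(2) using AP by (auto simp: sets_restrict_space)
    moreover have "L \<inter> (A \<inter> ?P) = A \<inter> ?P" using PL by auto
    ultimately have AP': "A \<inter> ?P \<in> sets \<nu>'" by simp
    have "(\<integral>\<^sup>+ z. indicator A z * indicator ?P z \<partial>\<nu>') = (\<integral>\<^sup>+ z. indicator (A \<inter> ?P) z \<partial>\<nu>')"
      by (intro nn_integral_cong) (simp add: indicator_inter_arith)
    also have "\<dots> = emeasure \<nu>' (A \<inter> ?P)" using AP' by simp
    also have "\<dots> = (\<integral>\<^sup>+ u. ennreal (sqrt (principal_minor K (g c (slice_point K (snd c x) u))))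
          * indicator (snd c ` (A \<inter> ?P)) (slice_point K (snd c x) u) \<partial>(PiM K (\<lambda>_. lborel)))"
      using x AP by (intro em c) auto
    also have "\<dots> = plaque_integral c (indicator A) (snd c x)"
      unfolding plaque_integral_def
    proof (rule nn_integral_cong)
      fix u :: "'n \<Rightarrow> real"
      let ?y = "slice_point K (snd c x) u"
      have "?y \<in> snd c ` (A \<inter> ?P) \<longleftrightarrow> ?y \<in> im c \<and> para c ?y \<in> A \<inter> ?P"
        using chart_image_eq[OF c, of "A \<inter> ?P"] plaque_sub[of c x] by blast
      also have "\<dots> \<longleftrightarrow> ?y \<in> im c \<and> para c ?y \<in> A"
      proof -
        have "para c ?y \<in> ?P" if "?y \<in> im c"
          using chart_para[OF that] para_in[OF that] by (simp add: plaque_def slice_point_nth)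
        then show ?thesis by blast
      qed
      finally show "ennreal (sqrt (principal_minor K (g c ?y))) * indicator (snd c ` (A \<inter> ?P)) ?y
          = plaque_density c (indicator A) ?y"
        by (simp add: plaque_density_def indicator_def)
    qed
    finally show ?case .
  next
    case (mult f a)
    have "(\<integral>\<^sup>+ z. a * f z * indicator ?P z \<partial>\<nu>') = a * (\<integral>\<^sup>+ z. f z * indicator ?P z \<partial>\<nu>')"
      unfolding mult.assoc by (intro nn_integral_cmult borel_measurable_times_ennreal m mult.hyps mP)
    also have "\<dots> = (\<integral>\<^sup>+ u. a * plaque_density c f (slice_point K (snd c x) u) \<partial>PiM K (\<lambda>_. lborel))"
      unfolding mult.IH plaque_integral_def
      by (intro nn_integral_cmult[symmetric] borel_plaque_density_slice c mult.hyps)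
    also have "\<dots> = plaque_integral c (\<lambda>z. a * f z) (snd c x)"
      unfolding plaque_integral_def by (intro nn_integral_cong) (simp add: plaque_density_def mult.left_commute)
    finally show ?case .
  next
    case (add f f')
    have "(\<integral>\<^sup>+ z. (f' z + f z) * indicator ?P z \<partial>\<nu>')
        = (\<integral>\<^sup>+ z. f' z * indicator ?P z \<partial>\<nu>') + (\<integral>\<^sup>+ z. f z * indicator ?P z \<partial>\<nu>')"
      unfolding distrib_right by (intro nn_integral_add borel_measurable_times_ennreal m add.hyps mP)
    also have "\<dots> = (\<integral>\<^sup>+ u. plaque_density c f' (slice_point K (snd c x) u) + plaque_density c f (slice_point K (snd c x) u) \<partial>PiM K (\<lambda>_. lborel))"
      unfolding add.IH plaque_integral_def
      by (intro nn_integral_add[symmetric] borel_plaque_density_slice c add.hyps)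
    also have "\<dots> = plaque_integral c (\<lambda>z. f' z + f z) (snd c x)"
      unfolding plaque_integral_def by (intro nn_integral_cong) (simp add: plaque_density_def distrib_left)
    finally show ?case .
  next
    case (seq U)
    have inc: "U i z \<le> U j z" if "i \<le> j" for i j z
      using monoD[OF seq.hyps(3) that] by (simp add: le_fun_def)
    have "(\<integral>\<^sup>+ z. (SUP i. U i) z * indicator ?P z \<partial>\<nu>') = (\<integral>\<^sup>+ z. (SUP i. U i z * indicator ?P z) \<partial>\<nu>')"
      by (simp add: SUP_mult_right_ennreal image_comp)
    also have "\<dots> = (SUP i. \<integral>\<^sup>+ z. U i z * indicator ?P z \<partial>\<nu>')"
      by (intro nn_integral_monotone_convergence_SUP borel_measurable_times_ennreal m seq.hyps mP)
         (auto simp: incseq_def le_fun_def intro!: mult_right_mono inc)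
    also have "\<dots> = (SUP i. \<integral>\<^sup>+ u. plaque_density c (U i) (slice_point K (snd c x) u) \<partial>PiM K (\<lambda>_. lborel))"
      unfolding seq.IH plaque_integral_def by simp
    also have "\<dots> = (\<integral>\<^sup>+ u. (SUP i. plaque_density c (U i) (slice_point K (snd c x) u)) \<partial>PiM K (\<lambda>_. lborel))"
      by (intro nn_integral_monotone_convergence_SUP[symmetric] borel_plaque_density_slice c seq.hyps)
         (auto simp: incseq_def le_fun_def plaque_density_def intro!: mult_left_mono inc)
    also have "\<dots> = plaque_integral c (SUP i. U i) (snd c x)"
      unfolding plaque_integral_def
      by (intro nn_integral_cong) (simp add: plaque_density_def SUP_mult_left_ennreal image_comp)
    finally show ?case .
  qed
  then show ?thesis by (simp add: \<nu>'(1) nn_integral_completion)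
qed

lemma leaf_measure_space:
  assumes "leaf_measure g K \<Phi> L \<mu>"
  shows "space \<mu> = L"
proof -
  obtain \<nu>' where \<nu>': "\<mu> = completion \<nu>'" "sets \<nu>' = sets (restrict_space borel L)"
    using assms unfolding leaf_measure_def by blast
  show ?thesis using sets_eq_imp_space_eq[OF \<nu>'(2)] by (simp add: \<nu>'(1) space_restrict_space)
qed

lemma leaf_measure_measurable:
  assumes "leaf_measure g K \<Phi> L \<mu>" "h \<in> borel_measurable borel"
  shows "h \<in> borel_measurable \<mu>"
proof -
  obtain \<nu>' where \<nu>': "\<mu> = completion \<nu>'" "sets \<nu>' = sets (restrict_space borel L)"
    using assms unfolding leaf_measure_def by blast
  have "h \<in> borel_measurable \<nu>'"
    unfolding measurable_cong_sets[OF \<nu>'(2) refl] by (rule measurable_restrict_space1[OF assms(2)])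
  then show ?thesis unfolding \<nu>'(1) by (rule measurable_completion)
qed

lemma leaf_measure_null_subset:
  assumes "leaf_measure g K \<Phi> L \<mu>" "A \<in> null_sets \<mu>" "B \<subseteq> A"
  shows "B \<in> null_sets \<mu>"
  using assms null_sets_completion_subset unfolding leaf_measure_def by metis

end

section \<open>The leaf integral as a Borel function\<close>

context riemannian_foliation_subatlas begin

definition base_chart :: "nat \<Rightarrow> ('a, 'n) chart" where
  "base_chart = from_nat_into C"

lemma range_base_chart: "range base_chart = C"
proof -
  have "C \<noteq> {}" using C_cover by auto
  then show ?thesis unfolding base_chart_def using countable_C by (rule range_from_nat_into)
qed

lemma base_chart_in: "base_chart n \<in> C" "base_chart n \<in> \<Phi>"
  using range_base_chart C_sub by auto

text \<open>Charts overlap; these Borel pieces assign each point to a single chart, so that leaf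
  integrals count it once.\<close>

definition piece :: "nat \<Rightarrow> 'a set" where
  "piece = disjointed (\<lambda>n. fst (base_chart n))"

lemma disjoint_piece: "disjoint_family piece"
  by (simp add: piece_def disjoint_family_disjointed)

lemma piece_subset: "piece n \<subseteq> fst (base_chart n)"
  unfolding piece_def by (rule disjointed_subset)

lemma UN_piece: "(\<Union>n. piece n) = UNIV"
proof -
  have "(\<Union>n. piece n) = (\<Union>c\<in>range base_chart. fst c)" by (simp add: piece_def UN_disjointed_eq)
  then show ?thesis by (simp only: range_base_chart C_cover)
qed

lemma borel_piece: "piece n \<in> sets borel"
proof -
  have "range piece \<subseteq> sets borel"
    unfolding piece_def using chart(1)[OF base_chart_in(2)] by (intro sets.range_disjointed_sets) auto
  then show ?thesis by auto
qed

definition dense_points :: "(real ^ 'n) set" where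
  "dense_points = (SOME D. countable D \<and> (\<forall>X. open X \<longrightarrow> X \<noteq> {} \<longrightarrow> (\<exists>d\<in>D. d \<in> X)))"

lemma dense_points:
  "countable dense_points" "open X \<Longrightarrow> X \<noteq> {} \<Longrightarrow> \<exists>d\<in>dense_points. d \<in> X"
proof -
  have "\<exists>D :: (real ^ 'n) set. countable D \<and> (\<forall>X. open X \<longrightarrow> X \<noteq> {} \<longrightarrow> (\<exists>d\<in>D. d \<in> X))"
    by (metis countable_dense_setE)
  from someI_ex[OF this]
  have D: "countable dense_points \<and> (\<forall>X. open X \<longrightarrow> X \<noteq> {} \<longrightarrow> (\<exists>d\<in>dense_points. d \<in> X))"
    unfolding dense_points_def .
  then show "countable dense_points" by (rule conjunct1)
  show "open X \<Longrightarrow> X \<noteq> {} \<Longrightarrow> \<exists>d\<in>dense_points. d \<in> X" using D by simp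
qed

definition base_hops :: "nat \<Rightarrow> 'a \<Rightarrow> 'a" where
  "base_hops k = hops (from_nat_into (lists (C \<times> dense_points)) k)"

lemma range_base_hops: "range base_hops = hops ` lists (C \<times> dense_points)"
proof -
  have "countable (lists (C \<times> dense_points))" using countable_C dense_points(1) by auto
  then have "range (from_nat_into (lists (C \<times> dense_points))) = lists (C \<times> dense_points)"
    by (intro range_from_nat_into) auto
  moreover have "range base_hops = hops ` range (from_nat_into (lists (C \<times> dense_points)))"
    unfolding base_hops_def[abs_def] by (simp only: image_image)
  ultimately show ?thesis by simp
qed

lemma base_hops:
  obtains w where "w \<in> lists (C \<times> UNIV)" "base_hops k = hops w"
proof -
  have "base_hops k \<in> hops ` lists (C \<times> dense_points)" using range_base_hops by auto
  then obtain w where w: "w \<in> lists (C \<times> dense_points)" "base_hops k = hops w" by (elim imageE)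
  have "lists (C \<times> dense_points) \<subseteq> lists (C \<times> UNIV)" by (intro lists_mono) auto
  then show ?thesis using that w by (meson subsetD)
qed

lemma borel_base_hops: "base_hops k \<in> borel_measurable borel"
  using base_hops[of k] borel_hops by metis

lemma base_hops_leaf: "L \<in> leaves K \<Phi> \<Longrightarrow> x \<in> L \<Longrightarrow> base_hops k x \<in> L"
  using base_hops[of k] hops_leaf by metis

text \<open>Different hops may end on the same plaque of the chart \<open>base_chart n\<close>; only the first one counts.\<close>

definition first_hop :: "nat \<Rightarrow> nat \<Rightarrow> 'a \<Rightarrow> bool" where
  "first_hop n k x \<longleftrightarrow> base_hops k x \<in> fst (base_chart n) \<and>
     (\<forall>j<k. base_hops j x \<in> fst (base_chart n) \<longrightarrow>
        base_hops k x \<notin> plaque K (base_chart n) (base_hops j x))"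

text \<open>Using the empty set for repeated hops makes the family indexed by all naturals
  disjoint.\<close>

definition hop_plaque :: "nat \<Rightarrow> 'a \<Rightarrow> nat \<Rightarrow> 'a set" where
  "hop_plaque n x k = (if first_hop n k x then plaque K (base_chart n) (base_hops k x) else {})"

lemma disjoint_hop_plaque: "disjoint_family (hop_plaque n x)"
proof -
  have False if jk: "j < k" and z: "z \<in> hop_plaque n x j" "z \<in> hop_plaque n x k" for j k z
  proof -
    have f: "first_hop n j x" "first_hop n k x"
      "z \<in> plaque K (base_chart n) (base_hops j x)" "z \<in> plaque K (base_chart n) (base_hops k x)"
      using z by (auto simp: hop_plaque_def split: if_splits)
    then have "plaque K (base_chart n) (base_hops j x) = plaque K (base_chart n) (base_hops k x)"
      using plaque_eq by metis
    then have "base_hops k x \<in> plaque K (base_chart n) (base_hops j x)"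
      using f(2) plaque_in[of "base_hops k x" "base_chart n"] by (simp add: first_hop_def)
    then show False using f jk unfolding first_hop_def by blast
  qed
  then show ?thesis unfolding disjoint_family_on_def by (metis disjoint_iff linorder_neqE_nat)
qed

text \<open>Some hop reaches the plaque of \<open>z\<close> by density, and the least such index is
  a first hop.\<close>

lemma UN_hop_plaque:
  assumes L: "L \<in> leaves K \<Phi>" "x \<in> L" and z: "z \<in> L" "z \<in> fst (base_chart n)"
  shows "\<exists>k. z \<in> hop_plaque n x k"
proof -
  let ?c = "base_chart n"
  let ?p = "\<lambda>k. base_hops k x \<in> plaque K ?c z"
  have "(x, z) \<in> (same_plaque C)\<^sup>*" using leaf_Image_subatlas[OF L] z(1) by blast
  then obtain w where "w \<in> lists (C \<times> dense_points)" "hops w x \<in> plaque K ?c z"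
    using hops_reach[OF dense_points(2) _ plaque_in_plaques[OF base_chart_in(1) z(2)] plaque_in[OF z(2)]] by metis
  moreover have "hops w \<in> range base_hops" using calculation(1) range_base_hops by auto
  ultimately obtain k0 where k0: "?p k0" by auto
  define k where "k = (LEAST k. ?p k)"
  have k: "?p k" unfolding k_def using k0 by (rule LeastI)
  have nk: "\<not> ?p j" if "j < k" for j using not_less_Least that unfolding k_def by blast
  have e: "plaque K ?c (base_hops k x) = plaque K ?c z" using plaque_eq[OF k] .
  have "first_hop n k x"
    unfolding first_hop_def
  proof (intro conjI allI impI notI)
    show "base_hops k x \<in> fst ?c" using k by (simp add: plaque_def)
    fix j assume j: "j < k" "base_hops j x \<in> fst ?c" "base_hops k x \<in> plaque K ?c (base_hops j x)"
    then have "plaque K ?c (base_hops j x) = plaque K ?c z" using e plaque_eq[OF j(3)] by simp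
    then show False using nk[OF j(1)] plaque_in[OF j(2)] by simp
  qed
  then have "z \<in> hop_plaque n x k" using e plaque_in[OF z(2)] by (simp add: hop_plaque_def)
  then show ?thesis by blast
qed

text \<open>The integral of \<open>h\<close> over the leaf through \<open>x\<close>, written without
  mentioning that leaf: each of its plaques in each chart is represented by the first hop from
  \<open>x\<close> that lands on it. Since the hops are Borel maps, measurability in
  \<open>x\<close> becomes accessible.\<close>

definition leaf_integral :: "('a \<Rightarrow> ennreal) \<Rightarrow> 'a \<Rightarrow> ennreal" where
  "leaf_integral h x = (\<Sum>n. \<Sum>k. if first_hop n k x
     then plaque_integral (base_chart n) (\<lambda>z. h z * indicator (piece n) z)
            (snd (base_chart n) (base_hops k x))
     else 0)"

text \<open>For fixed \<open>x\<close> the sets \<open>piece n \<inter> hop_plaque n x k\<close>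
  partition the leaf, so its integral splits into plaque integrals.\<close>

lemma nn_integral_leaf:
  assumes \<mu>: "leaf_measure g K \<Phi> L \<mu>" and L: "L \<in> leaves K \<Phi>" "x \<in> L"
    and h: "h \<in> borel_measurable borel"
  shows "(\<integral>\<^sup>+ z. h z \<partial>\<mu>) = leaf_integral h x"
proof -
  let ?h = "\<lambda>n z. h z * indicator (piece n) z"
  have hb: "?h n \<in> borel_measurable borel" for n
    using borel_piece[of n] h by (intro borel_measurable_times_ennreal borel_measurable_indicator)
  have hp: "hop_plaque n x k \<in> sets borel" for n k
    using borel_plaque[OF base_chart_in(2)] by (simp add: hop_plaque_def)
  have hhb: "(\<lambda>z. ?h n z * indicator (hop_plaque n x k) z) \<in> borel_measurable borel" for n k
    by (rule borel_measurable_times_ennreal[OF hb borel_measurable_indicator[OF hp]])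
  have inner: "(\<Sum>k. ?h n z * indicator (hop_plaque n x k) z) = ?h n z" if "z \<in> L" for n z
  proof (cases "z \<in> piece n")
    case True
    then have "z \<in> fst (base_chart n)" using piece_subset by auto
    from UN_hop_plaque[OF L that this] obtain k where "z \<in> hop_plaque n x k" by blast
    from suminf_cmult_indicator[OF disjoint_hop_plaque this, of "\<lambda>_. ?h n z"] show ?thesis .
  qed simp
  have outer: "(\<Sum>n. ?h n z) = h z" for z
  proof -
    have "z \<in> (\<Union>n. piece n)" unfolding UN_piece by simp
    then obtain n where "z \<in> piece n" by blast
    from suminf_cmult_indicator[OF disjoint_piece this, of "\<lambda>_. h z"] show ?thesis .
  qed
  have "(\<integral>\<^sup>+ z. h z \<partial>\<mu>) = (\<integral>\<^sup>+ z. (\<Sum>n. \<Sum>k. ?h n z * indicator (hop_plaque n x k) z) \<partial>\<mu>)"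
  proof (rule nn_integral_cong)
    fix z assume "z \<in> space \<mu>"
    then have "z \<in> L" using leaf_measure_space[OF \<mu>] by simp
    then show "h z = (\<Sum>n. \<Sum>k. ?h n z * indicator (hop_plaque n x k) z)"
      using outer[of z] by (simp only: inner)
  qed
  also have "\<dots> = (\<Sum>n. \<integral>\<^sup>+ z. (\<Sum>k. ?h n z * indicator (hop_plaque n x k) z) \<partial>\<mu>)"
    by (intro nn_integral_suminf borel_measurable_suminf_order leaf_measure_measurable[OF \<mu>] hhb)
  also have "\<dots> = (\<Sum>n. \<Sum>k. \<integral>\<^sup>+ z. ?h n z * indicator (hop_plaque n x k) z \<partial>\<mu>)"
    by (intro suminf_cong nn_integral_suminf leaf_measure_measurable[OF \<mu>] hhb)
  also have "\<dots> = leaf_integral h x"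
    unfolding leaf_integral_def
  proof (intro suminf_cong)
    fix n k
    show "(\<integral>\<^sup>+ z. ?h n z * indicator (hop_plaque n x k) z \<partial>\<mu>) =
      (if first_hop n k x then plaque_integral (base_chart n) (?h n) (snd (base_chart n) (base_hops k x)) else 0)"
    proof (cases "first_hop n k x")
      case True
      then have "base_hops k x \<in> fst (base_chart n)" by (simp add: first_hop_def)
      from nn_integral_plaque[OF \<mu> L(1) base_chart_in(2) this base_hops_leaf[OF L] hb]
      show ?thesis using True by (simp add: hop_plaque_def)
    qed (simp add: hop_plaque_def)
  qed
  finally show ?thesis .
qed

text \<open>The delicate point is \<open>first_hop\<close>: it compares a hop with finitely many
  earlier ones, and lying on a common plaque is equality of finitely many coordinates of Borel
  maps.\<close>

lemma borel_leaf_integral: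
  assumes h: "h \<in> borel_measurable borel"
  shows "leaf_integral h \<in> borel_measurable borel"
proof -
  let ?c = base_chart
  \<comment> \<open>Extended by 0 off the chart; its values matter below only where the hop lies in
    the chart.\<close>
  define \<phi> where "\<phi> n k x = (if base_hops k x \<in> fst (?c n) then snd (?c n) (base_hops k x) else 0)" for n k x
  have \<phi>: "\<phi> n k \<in> borel_measurable borel" for n k
    unfolding \<phi>_def[abs_def] using measurable_compose[OF borel_base_hops borel_chart[OF base_chart_in(2)]] .
  have dom: "{x. base_hops k x \<in> fst (?c n)} \<in> sets borel" for n k
    using measurable_sets[OF borel_base_hops borel_open[OF chart(1)[OF base_chart_in(2)]]] by (simp add: vimage_def)
  have eq: "{x. \<phi> n k x $ i = \<phi> n j x $ i} \<in> sets borel" for n k j i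
    using borel_measurable_eq[OF measurable_compose[OF \<phi> borel_measurable_nth] measurable_compose[OF \<phi> borel_measurable_nth]]
    by (simp add: pred_def)
  have "{x. first_hop n k x} = {x. base_hops k x \<in> fst (?c n)} \<inter>
    (\<Inter>j\<in>{..<k}. - ({x. base_hops j x \<in> fst (?c n)} \<inter> {x. base_hops k x \<in> fst (?c n)} \<inter>
        (\<Inter>i\<in>UNIV. if i \<in> K then UNIV else {x. \<phi> n k x $ i = \<phi> n j x $ i})))" for n k
    by (auto simp: first_hop_def plaque_def \<phi>_def split: if_splits)
  moreover have "{x. base_hops k x \<in> fst (?c n)} \<inter>
    (\<Inter>j\<in>{..<k}. - ({x. base_hops j x \<in> fst (?c n)} \<inter> {x. base_hops k x \<in> fst (?c n)} \<inter>
        (\<Inter>i\<in>UNIV. if i \<in> K then UNIV else {x. \<phi> n k x $ i = \<phi> n j x $ i}))) \<in> sets borel" for n k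
    using dom eq by (intro sets.Int sets.countable_INT'' borel_comp) auto
  ultimately have first: "{x. first_hop n k x} \<in> sets borel" for n k by (simp only:)
  have summand: "(\<lambda>x. if first_hop n k x
     then plaque_integral (?c n) (\<lambda>z. h z * indicator (piece n) z) (snd (?c n) (base_hops k x)) else 0)
     \<in> borel_measurable borel" for n k
  proof -
    have hb: "(\<lambda>z. h z * indicator (piece n) z) \<in> borel_measurable borel"
      using borel_piece[of n] h by (intro borel_measurable_times_ennreal borel_measurable_indicator)
    have "(\<lambda>x. if x \<in> {x. first_hop n k x}
      then plaque_integral (?c n) (\<lambda>z. h z * indicator (piece n) z) (\<phi> n k x) else 0) \<in> borel_measurable borel"
      using first[of n k] by (intro measurable_If_set measurable_compose[OF \<phi> borel_plaque_integral[OF base_chart_in(2) hb]]) auto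
    also have "(\<lambda>x. if x \<in> {x. first_hop n k x}
      then plaque_integral (?c n) (\<lambda>z. h z * indicator (piece n) z) (\<phi> n k x) else 0) =
      (\<lambda>x. if first_hop n k x
     then plaque_integral (?c n) (\<lambda>z. h z * indicator (piece n) z) (snd (?c n) (base_hops k x)) else 0)"
      by (auto simp: fun_eq_iff \<phi>_def first_hop_def)
    finally show ?thesis .
  qed
  show ?thesis unfolding leaf_integral_def[abs_def] by (intro borel_measurable_suminf_order summand)
qed

text \<open>Every point lies on a leaf and \<open>leaf_integral h\<close> gives the integral over
  that leaf, so this union of leaves is the level set of a Borel function at infinity.\<close>

lemma infinite_leaves_borel:
  assumes \<mu>: "\<And>L. L \<in> leaves K \<Phi> \<Longrightarrow> leaf_measure g K \<Phi> L (\<mu> L)"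
    and h: "h \<in> borel_measurable borel"
  shows "\<Union>{L \<in> leaves K \<Phi>. (\<integral>\<^sup>+ x. h x \<partial>\<mu> L) = \<infinity>} \<in> sets borel"
proof -
  have ex: "\<exists>L\<in>leaves K \<Phi>. x \<in> L" for x
    using Union_quotient[OF equiv_leaf[of \<Phi>]] by (auto simp: leaves_eq)
  have "\<Union>{L \<in> leaves K \<Phi>. (\<integral>\<^sup>+ x. h x \<partial>\<mu> L) = \<infinity>} = leaf_integral h -` {\<infinity>} \<inter> space borel"
  proof (intro equalityI subsetI)
    fix x assume "x \<in> \<Union>{L \<in> leaves K \<Phi>. (\<integral>\<^sup>+ x. h x \<partial>\<mu> L) = \<infinity>}"
    then obtain L where "L \<in> leaves K \<Phi>" "x \<in> L" "(\<integral>\<^sup>+ x. h x \<partial>\<mu> L) = \<infinity>" by blast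
    then show "x \<in> leaf_integral h -` {\<infinity>} \<inter> space borel"
      using nn_integral_leaf[OF \<mu> _ _ h] by simp
  next
    fix x assume x: "x \<in> leaf_integral h -` {\<infinity>} \<inter> space borel"
    obtain L where L: "L \<in> leaves K \<Phi>" "x \<in> L" using ex by blast
    then have "(\<integral>\<^sup>+ x. h x \<partial>\<mu> L) = \<infinity>"
      using nn_integral_leaf[OF \<mu>[OF L(1)] L h] x by simp
    then show "x \<in> \<Union>{L \<in> leaves K \<Phi>. (\<integral>\<^sup>+ x. h x \<partial>\<mu> L) = \<infinity>}" using L by blast
  qed
  also have "\<dots> \<in> sets borel" by (rule measurable_sets[OF borel_leaf_integral[OF h]]) simp
  finally show ?thesis .
qed

text \<open>Points whose plaque meets the null set in positive measure form, by Fubini, a null set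
  made of whole plaques. The leaves containing such points are therefore negligible, and on every
  other leaf all plaque integrals vanish.\<close>

lemma null_leaves:
  assumes \<mu>: "\<And>L. L \<in> leaves K \<Phi> \<Longrightarrow> leaf_measure g K \<Phi> L (\<mu> L)"
    and Z: "Z \<in> null_sets (completion \<nu>)"
  shows "almost_every_leaf (completion \<nu>) (leaves K \<Phi>) (\<lambda>L. Z \<inter> L \<in> null_sets (\<mu> L))"
proof -
  \<comment> \<open>A Borel null superset, so that slices and leaf integrals of its indicator are
    measurable.\<close>
  obtain Z' where Z': "Z' \<in> null_sets \<nu>" "Z \<subseteq> Z'" using Z by (auto simp: null_sets_completion_iff2)
  have Z'b: "Z' \<in> sets borel" using null_setsD2[OF Z'(1)] by (simp only: sets_\<nu>)
  define S where "S c = snd c ` (Z' \<inter> fst c)" for c :: "('a, 'n) chart"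
  define bad where "bad c = {x \<in> fst c. snd c x \<in> {y. \<not> null_slice K (S c) y}}" for c
  have S: "S c \<in> null_sets lborel" if "c \<in> \<Phi>" for c
    unfolding S_def by (rule null_borel_image[OF that Z'(1)])
  have bad_null: "bad c \<in> null_sets (completion \<nu>)" if "c \<in> \<Phi>" for c
    unfolding bad_def by (intro null_sets_completionI null_vimage that null_sets_non_null_slices S)
  have bad_open: "leafwise_open (bad c)" if "c \<in> \<Phi>" for c
  proof (rule leafwise_open_plaques[OF that])
    fix x assume x: "x \<in> bad c"
    show "plaque K c x \<subseteq> bad c"
    proof
      fix z assume z: "z \<in> plaque K c x"
      \<comment> \<open>The slice condition sees only transversal coordinates, so
        \<open>bad c\<close> contains the whole plaque of each of its points.\<close>
      then have "slice_point K (snd c z) = slice_point K (snd c x)"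
        by (auto simp: fun_eq_iff vec_eq_iff slice_point_nth plaque_def)
      then show "z \<in> bad c" using x z by (auto simp: bad_def null_slice_def plaque_def)
    qed
  qed (auto simp: bad_def)
  define B where "B = (\<Union>c\<in>C. bad c)"
  have "leafwise_open B" unfolding B_def using bad_open C_sub by (intro leafwise_open_UN) auto
  moreover have "B \<in> null_sets (completion \<nu>)"
    unfolding B_def using bad_null C_sub countable_C by (intro null_sets_UN') auto
  ultimately have null: "\<Union>{L \<in> leaves K \<Phi>. L \<inter> B \<noteq> {}} \<in> null_sets (completion \<nu>)"
    by (rule null_leaves_meeting)
  have good: "Z \<inter> L \<in> null_sets (\<mu> L)" if L: "L \<in> leaves K \<Phi>" "L \<inter> B = {}" for L
  proof (cases "L = {}")
    case False
    then obtain x where x: "x \<in> L" by blast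
    let ?h = "\<lambda>n z. indicator Z' z * indicator (piece n) z :: ennreal"
    have zero: "plaque_integral (base_chart n) (?h n) (snd (base_chart n) s) = 0"
      if s: "s \<in> L" "s \<in> fst (base_chart n)" for n s
    proof -
      let ?c = "base_chart n" and ?y = "slice_point K (snd (base_chart n) s)"
      have "s \<notin> bad ?c" using s L(2) base_chart_in(1) by (auto simp: B_def)
      then have ns: "(\<integral>\<^sup>+ u. indicator (S ?c) (?y u) \<partial>PiM K (\<lambda>_. lborel)) = 0"
        using s(2) by (simp add: bad_def null_slice_def)
      have "S ?c \<in> sets borel" using null_setsD2[OF S[OF base_chart_in(2)]] by simp
      then have "(\<lambda>u. indicator (S ?c) (?y u) :: ennreal) \<in> borel_measurable (PiM K (\<lambda>_. lborel))"
        by (intro measurable_compose[OF measurable_slice_point borel_measurable_indicator])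
      then have "AE u in PiM K (\<lambda>_. lborel). (indicator (S ?c) (?y u) :: ennreal) = 0"
        using ns nn_integral_0_iff_AE by blast
      then have "AE u in PiM K (\<lambda>_. lborel). plaque_density ?c (?h n) (?y u) = 0"
      proof eventually_elim
        case (elim u)
        have "para ?c (?y u) \<notin> Z'" if y: "?y u \<in> im ?c"
        proof
          assume "para ?c (?y u) \<in> Z'"
          then have "snd ?c (para ?c (?y u)) \<in> S ?c" unfolding S_def using para_in[OF y] by blast
          then show False using elim chart_para[OF y] by simp
        qed
        then show ?case by (simp add: plaque_density_def)
      qed
      then have "plaque_integral ?c (?h n) (snd ?c s) = (\<integral>\<^sup>+ u. 0 \<partial>PiM K (\<lambda>_. lborel :: real measure))"
        unfolding plaque_integral_def by (intro nn_integral_cong_AE)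
      then show ?thesis by simp
    qed
    have "(\<integral>\<^sup>+ z. indicator Z' z \<partial>\<mu> L) = leaf_integral (indicator Z') x"
      using Z'b by (intro nn_integral_leaf[OF \<mu> L(1) x] L(1)) simp
    also have "\<dots> = (\<Sum>n::nat. \<Sum>k::nat. 0)"
      unfolding leaf_integral_def
    proof (intro suminf_cong)
      fix n k
      show "(if first_hop n k x then plaque_integral (base_chart n) (?h n)
          (snd (base_chart n) (base_hops k x)) else 0) = 0"
        using zero[OF base_hops_leaf[OF L(1) x, of k], of n] by (auto simp only: first_hop_def split: if_split)
    qed
    finally have int0: "(\<integral>\<^sup>+ z. indicator Z' z \<partial>\<mu> L) = 0" by simp
    note mZ = leaf_measure_measurable[OF \<mu>[OF L(1)] borel_measurable_indicator[OF Z'b]]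
    have "(indicator Z' :: 'a \<Rightarrow> ennreal) -` {1} \<inter> space (\<mu> L) \<in> sets (\<mu> L)"
      by (rule measurable_sets[OF mZ]) simp
    moreover have "(indicator Z' :: 'a \<Rightarrow> ennreal) -` {1} \<inter> space (\<mu> L) = Z' \<inter> L"
      using leaf_measure_space[OF \<mu>[OF L(1)]] by (auto simp: indicator_def)
    ultimately have sZ: "Z' \<inter> L \<in> sets (\<mu> L)" by simp
    have "emeasure (\<mu> L) (Z' \<inter> L) = (\<integral>\<^sup>+ z. indicator (Z' \<inter> L) z \<partial>\<mu> L)" using sZ by simp
    also have "\<dots> = (\<integral>\<^sup>+ z. indicator Z' z \<partial>\<mu> L)"
      using leaf_measure_space[OF \<mu>[OF L(1)]] by (intro nn_integral_cong) (auto simp: indicator_def)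
    finally have "Z' \<inter> L \<in> null_sets (\<mu> L)" using sZ int0 by (simp add: null_sets_def)
    then show ?thesis by (rule leaf_measure_null_subset[OF \<mu>[OF L(1)]]) (use Z'(2) in auto)
  qed simp
  show ?thesis
    unfolding almost_every_leaf_def
    by (rule null_sets_completion_subset[OF _ null]) (use good in auto)
qed

end

theorem theorem3p1:
  fixes \<A> :: "('a::{t2_space, second_countable_topology}, 'n::finite) chart set"
    and g :: "('a, 'n) chart \<Rightarrow> real ^ 'n \<Rightarrow> real ^ 'n ^ 'n"
    and K :: "'n set"
    and \<Phi> :: "('a, 'n) chart set"
    and \<F> :: "'a set set"
    and \<mu>M :: "'a measure"
    and \<mu>L :: "'a set \<Rightarrow> 'a measure"
    and p :: real
  assumes "smooth_structure \<A>"
    and "riemannian_metric \<A> g"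
    and "foliated_atlas \<A> K \<Phi>"
    and "\<F> = leaves K \<Phi>"
    and "riemannian_measure \<A> g \<mu>M"
    and "\<And>L. L \<in> \<F> \<Longrightarrow> leaf_measure g K \<Phi> L (\<mu>L L)"
    and "p > 1"
    and "modulus p \<mu>M \<mu>L \<F> < \<infinity>"
  shows "(\<exists>f\<^sub>0. extremal p \<mu>M \<mu>L \<F> f\<^sub>0) \<longleftrightarrow>
    (\<forall>\<L>\<subseteq>\<F>. \<Union>\<L> \<in> sets \<mu>M \<and> emeasure \<mu>M (\<Union>\<L>) > 0 \<longrightarrow> modulus p \<mu>M \<mu>L \<L> > 0)"
proof -
  obtain \<nu> where \<nu>: "\<mu>M = completion \<nu>" "sets \<nu> = sets borel"
    and em: "\<And>c A. c \<in> \<A> \<Longrightarrow> A \<in> sets borel \<Longrightarrow> A \<subseteq> fst c \<Longrightarrow> emeasure \<nu> A =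
          (\<integral>\<^sup>+ y. ennreal (sqrt (det (g c y))) * indicator (snd c ` A) y \<partial>lborel)"
    using assms(5) unfolding riemannian_measure_def by blast
  interpret riemannian_foliation \<A> g K \<Phi> \<nu>
    by standard (fact assms(1-3) \<nu>(2) em)+
  obtain C where C: "countable C" "C \<subseteq> \<Phi>" "(\<Union>c\<in>C. fst c) = UNIV"
    by (rule ex_countable_subatlas)
  interpret riemannian_foliation_subatlas \<A> g K \<Phi> \<nu> C
    by standard (fact C)+
  have leaf: "leaf_measure g K \<Phi> L (\<mu>L L)" if "L \<in> leaves K \<Phi>" for L
    using assms(4,6) that by simp
  have borel_\<nu>: "h \<in> borel_measurable borel" if "h \<in> borel_measurable \<nu>" for h :: "'a \<Rightarrow> ennreal"
    using that unfolding measurable_cong_sets[OF \<nu>(2) refl] .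
  interpret leaf_family \<nu> \<mu>L \<F> \<mu>M
  proof
    show "space \<nu> = UNIV" using sets_eq_imp_space_eq[OF \<nu>(2)] by simp
    show "L = L'" if "L \<in> \<F>" "L' \<in> \<F>" "x \<in> L" "x \<in> L'" for L L' x
      using leaf_disjoint that unfolding assms(4) by blast
    show "space (\<mu>L L) = L" if "L \<in> \<F>" for L
      using that unfolding assms(4) by (intro leaf_measure_space leaf)
    show "h \<in> borel_measurable (\<mu>L L)" if "L \<in> \<F>" "h \<in> borel_measurable \<nu>"
      for L and h :: "'a \<Rightarrow> ennreal"
      using leaf_measure_measurable[OF leaf borel_\<nu>[OF that(2)]] that(1) unfolding assms(4) by simp
    show "almost_every_leaf \<mu>M \<F> (\<lambda>L. Z \<inter> L \<in> null_sets (\<mu>L L))" if "Z \<in> null_sets \<mu>M" for Z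
      using null_leaves[OF leaf] that unfolding \<nu>(1) assms(4) by simp
    show "\<Union>{L \<in> \<F>. (\<integral>\<^sup>+ x. h x \<partial>\<mu>L L) = \<infinity>} \<in> sets \<mu>M" if "h \<in> borel_measurable \<nu>"
      for h :: "'a \<Rightarrow> ennreal"
      using infinite_leaves_borel[OF leaf borel_\<nu>[OF that]] sets_completionI_sets[of _ \<nu>]
      unfolding \<nu> assms(4) by simp
  qed (fact \<nu>(1))
  \<comment> \<open>Finite modulus excludes the convention for an empty \<open>adm\<close>, so the
    infimum is taken over a nonempty set.\<close>
  have "adm p \<mu>M \<mu>L \<F> \<noteq> {}" using assms(8) by (auto simp: modulus_def)
  then show ?thesis
    using modulus_pos_if_extremal[OF assms(7)] ex_extremal[OF assms(7)] by blast
qed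

end
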